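(* Suppose $\aleph_0\le\kappa<\lambda\le\mu$ are cardinals with $\mu^\kappa=\mu$ and $\lambda$ regular. Then there exist a complete Boolean algebra $\mathcal B$ with the $\kappa^+$-c.c. and an $\aleph_1$-incomplete, $\kappa^+$-good ultrafilter $\mathcal U$ on $\mathcal B$ such that $\mu_{\mathcal U}=\mu$ and $\mathrm{lcf}_{\mathcal U}(\omega)=\lambda$.
   Context: For a complete Boolean algebra $\mathcal B$, $(\omega,<)^{\mathcal B}$ is the set of all $\mathbf n:\omega\to\mathcal B$ with $\mathbf n(n)\wedge\mathbf n(m)=0$ for $n\ne m$ and $\bigvee_n\mathbf n(n)=1$, with Boolean truth values $\|\mathbf n<\mathbf m\|=\bigvee_{n<m}\mathbf n(n)\wedge\mathbf m(m)$ and $\|\mathbf n=\mathbf m\|=\bigvee_n\mathbf n(n)\wedge\mathbf m(n)$. For an ultrafilter $\mathcal U$ on $\mathcal B$, $(\omega,<)^{\mathcal B}/\mathcal U$ is the linear order obtained by identifying $\mathbf n,\mathbf m$ when $\|\mathbf n=\mathbf m\|\in\mathcal U$ and setting $[\mathbf n]<[\mathbf m]$ iff $\|\mathbf n<\mathbf m\|\in\mathcal U$; it is an elementary extension of $(\omega,<)$ (via constant partitions). For a linear order $L$ with proper initial segment $\omega$: $\mu_L$ is the least cardinality of an initial segment of $L$ properly containing $\omega$, and $\mathrm{lcf}_L(\omega)$ is the least $\kappa$ such that there is a decreasing sequence $(a_\alpha:\alpha<\kappa)$ in $L\setminus\omega$ such that every $a\in L$ below all $a_\alpha$ lies in $\omega$.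 $\mu_{\mathcal U}=\mu_{(\omega,<)^{\mathcal B}/\mathcal U}$ and $\mathrm{lcf}_{\mathcal U}(\omega)=\mathrm{lcf}_{(\omega,<)^{\mathcal B}/\mathcal U}(\omega)$. $\mathcal U$ is $\aleph_1$-incomplete if there is a countable subset of $\mathcal U$ whose meet in $\mathcal B$ is not in $\mathcal U$. A $\kappa$-distribution in $\mathcal B$ is $\mathbf A:[\kappa]^{<\aleph_0}\to\mathcal B$ with $\mathbf A(\emptyset)=1$ and $s\subseteq t\Rightarrow\mathbf A(s)\ge\mathbf A(t)$; it is in $\mathcal U$ if all values lie in $\mathcal U$; it is multiplicative if $\mathbf A(s)=\bigwedge_{\alpha\in s}\mathbf A(\{\alpha\})$; $\mathbf B$ refines $\mathbf A$ if $\mathbf B(s)\le\mathbf A(s)$ for all $s$. $\mathcal U$ is $\kappa^+$-good if every $\kappa$-distribution in $\mathcal U$ has a multiplicative refinement in $\mathcal U$. *)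

theory Defs
  imports Main "HOL-Library.Countable_Set"
begin

unbundle cardinal_syntax

definition is_lub :: "'b set \<Rightarrow> ('b \<Rightarrow> 'b \<Rightarrow> bool) \<Rightarrow> 'b set \<Rightarrow> 'b \<Rightarrow> bool" where
  "is_lub C le S x \<longleftrightarrow> x \<in> C \<and> (\<forall>s\<in>S. le s x) \<and> (\<forall>y\<in>C. (\<forall>s\<in>S. le s y) \<longrightarrow> le x y)"

definition is_glb :: "'b set \<Rightarrow> ('b \<Rightarrow> 'b \<Rightarrow> bool) \<Rightarrow> 'b set \<Rightarrow> 'b \<Rightarrow> bool" where
  "is_glb C le S x \<longleftrightarrow> x \<in> C \<and> (\<forall>s\<in>S. le x s) \<and> (\<forall>y\<in>C. (\<forall>s\<in>S. le y s) \<longrightarrow> le y x)"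

definition bsup :: "'b set \<Rightarrow> ('b \<Rightarrow> 'b \<Rightarrow> bool) \<Rightarrow> 'b set \<Rightarrow> 'b" where
  "bsup C le S = (THE x. is_lub C le S x)"

definition binf :: "'b set \<Rightarrow> ('b \<Rightarrow> 'b \<Rightarrow> bool) \<Rightarrow> 'b set \<Rightarrow> 'b" where
  "binf C le S = (THE x. is_glb C le S x)"

definition bjoin :: "'b set \<Rightarrow> ('b \<Rightarrow> 'b \<Rightarrow> bool) \<Rightarrow> 'b \<Rightarrow> 'b \<Rightarrow> 'b" where
  "bjoin C le a b = bsup C le {a, b}"

definition bmeet :: "'b set \<Rightarrow> ('b \<Rightarrow> 'b \<Rightarrow> bool) \<Rightarrow> 'b \<Rightarrow> 'b \<Rightarrow> 'b" where
  "bmeet C le a b = binf C le {a, b}"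

definition bzero :: "'b set \<Rightarrow> ('b \<Rightarrow> 'b \<Rightarrow> bool) \<Rightarrow> 'b" where
  "bzero C le = bsup C le {}"

definition bone :: "'b set \<Rightarrow> ('b \<Rightarrow> 'b \<Rightarrow> bool) \<Rightarrow> 'b" where
  "bone C le = binf C le {}"

definition bcompl :: "'b set \<Rightarrow> ('b \<Rightarrow> 'b \<Rightarrow> bool) \<Rightarrow> 'b \<Rightarrow> 'b" where
  "bcompl C le a = (THE b. b \<in> C \<and> bmeet C le a b = bzero C le \<and> bjoin C le a b = bone C le)"

definition complete_BA :: "'b set \<Rightarrow> ('b \<Rightarrow> 'b \<Rightarrow> bool) \<Rightarrow> bool" where
  "complete_BA C le \<longleftrightarrow>
     (\<forall>a\<in>C. le a a) \<and>
     (\<forall>a\<in>C. \<forall>b\<in>C. le a b \<and> le b a \<longrightarrow> a = b) \<and>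
     (\<forall>a\<in>C. \<forall>b\<in>C. \<forall>c\<in>C. le a b \<and> le b c \<longrightarrow> le a c) \<and>
     (\<forall>S. S \<subseteq> C \<longrightarrow> (\<exists>x. is_lub C le S x) \<and> (\<exists>x. is_glb C le S x)) \<and>
     (\<forall>a\<in>C. \<forall>b\<in>C. \<forall>c\<in>C.
        bmeet C le a (bjoin C le b c) = bjoin C le (bmeet C le a b) (bmeet C le a c)) \<and>
     (\<forall>a\<in>C. \<exists>b\<in>C. bmeet C le a b = bzero C le \<and> bjoin C le a b = bone C le)"

definition chain_condition :: "'b set \<Rightarrow> ('b \<Rightarrow> 'b \<Rightarrow> bool) \<Rightarrow> 'c rel \<Rightarrow> bool" where
  "chain_condition C le \<theta> \<longleftrightarrow>
     (\<forall>A. A \<subseteq> C - {bzero C le} \<and>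
          (\<forall>a\<in>A. \<forall>b\<in>A. a \<noteq> b \<longrightarrow> bmeet C le a b = bzero C le) \<longrightarrow> card_of A <o \<theta>)"

definition BA_ultrafilter :: "'b set \<Rightarrow> ('b \<Rightarrow> 'b \<Rightarrow> bool) \<Rightarrow> 'b set \<Rightarrow> bool" where
  "BA_ultrafilter C le U \<longleftrightarrow>
     U \<subseteq> C \<and> bone C le \<in> U \<and> bzero C le \<notin> U \<and>
     (\<forall>a\<in>U. \<forall>b\<in>C. le a b \<longrightarrow> b \<in> U) \<and>
     (\<forall>a\<in>U. \<forall>b\<in>U. bmeet C le a b \<in> U) \<and>
     (\<forall>a\<in>C. a \<in> U \<or> bcompl C le a \<in> U)"

definition aleph1_incomplete :: "'b set \<Rightarrow> ('b \<Rightarrow> 'b \<Rightarrow> bool) \<Rightarrow> 'b set \<Rightarrow> bool" where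
  "aleph1_incomplete C le U \<longleftrightarrow> (\<exists>X. X \<subseteq> U \<and> countable X \<and> binf C le X \<notin> U)"

text \<open>A \<kappa>-distribution, with \<kappa> represented by an index set K of that
  cardinality; it is a map on finite subsets of K.\<close>
definition distribution :: "'b set \<Rightarrow> ('b \<Rightarrow> 'b \<Rightarrow> bool) \<Rightarrow> 'k set \<Rightarrow> ('k set \<Rightarrow> 'b) \<Rightarrow> bool" where
  "distribution C le K A \<longleftrightarrow>
     A {} = bone C le \<and>
     (\<forall>s. finite s \<and> s \<subseteq> K \<longrightarrow> A s \<in> C) \<and>
     (\<forall>s t. finite t \<and> t \<subseteq> K \<and> s \<subseteq> t \<longrightarrow> le (A t) (A s))"

definition distribution_in :: "'k set \<Rightarrow> 'b set \<Rightarrow> ('k set \<Rightarrow> 'b) \<Rightarrow> bool" where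
  "distribution_in K U A \<longleftrightarrow> (\<forall>s. finite s \<and> s \<subseteq> K \<longrightarrow> A s \<in> U)"

definition multiplicative :: "'b set \<Rightarrow> ('b \<Rightarrow> 'b \<Rightarrow> bool) \<Rightarrow> 'k set \<Rightarrow> ('k set \<Rightarrow> 'b) \<Rightarrow> bool" where
  "multiplicative C le K A \<longleftrightarrow>
     (\<forall>s. finite s \<and> s \<subseteq> K \<longrightarrow> A s = binf C le ((\<lambda>\<alpha>. A {\<alpha>}) ` s))"

definition refines :: "('b \<Rightarrow> 'b \<Rightarrow> bool) \<Rightarrow> 'k set \<Rightarrow> ('k set \<Rightarrow> 'b) \<Rightarrow> ('k set \<Rightarrow> 'b) \<Rightarrow> bool" where
  "refines le K B A \<longleftrightarrow> (\<forall>s. finite s \<and> s \<subseteq> K \<longrightarrow> le (B s) (A s))"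

text \<open>U is \<kappa>^+-good, where \<kappa> = |K|.\<close>
definition good :: "'b set \<Rightarrow> ('b \<Rightarrow> 'b \<Rightarrow> bool) \<Rightarrow> 'b set \<Rightarrow> 'k set \<Rightarrow> bool" where
  "good C le U K \<longleftrightarrow>
     (\<forall>A. distribution C le K A \<and> distribution_in K U A \<longrightarrow>
        (\<exists>B. distribution C le K B \<and> multiplicative C le K B \<and> refines le K B A \<and>
             distribution_in K U B))"

definition partitions :: "'b set \<Rightarrow> ('b \<Rightarrow> 'b \<Rightarrow> bool) \<Rightarrow> (nat \<Rightarrow> 'b) set" where
  "partitions C le = {n. (\<forall>i. n i \<in> C) \<and>
      (\<forall>i j. i \<noteq> j \<longrightarrow> bmeet C le (n i) (n j) = bzero C le) \<and>
      bsup C le (range n) = bone C le}"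

definition tv_less :: "'b set \<Rightarrow> ('b \<Rightarrow> 'b \<Rightarrow> bool) \<Rightarrow> (nat \<Rightarrow> 'b) \<Rightarrow> (nat \<Rightarrow> 'b) \<Rightarrow> 'b" where
  "tv_less C le n m = bsup C le {bmeet C le (n i) (m j) | i j. i < j}"

definition tv_eq :: "'b set \<Rightarrow> ('b \<Rightarrow> 'b \<Rightarrow> bool) \<Rightarrow> (nat \<Rightarrow> 'b) \<Rightarrow> (nat \<Rightarrow> 'b) \<Rightarrow> 'b" where
  "tv_eq C le n m = bsup C le {bmeet C le (n i) (m i) | i. True}"

definition const_part :: "'b set \<Rightarrow> ('b \<Rightarrow> 'b \<Rightarrow> bool) \<Rightarrow> nat \<Rightarrow> (nat \<Rightarrow> 'b)" where
  "const_part C le k = (\<lambda>i. if i = k then bone C le else bzero C le)"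

definition eqU :: "'b set \<Rightarrow> ('b \<Rightarrow> 'b \<Rightarrow> bool) \<Rightarrow> 'b set \<Rightarrow> ((nat \<Rightarrow> 'b) \<times> (nat \<Rightarrow> 'b)) set" where
  "eqU C le U = {(n, m). n \<in> partitions C le \<and> m \<in> partitions C le \<and> tv_eq C le n m \<in> U}"

definition upow :: "'b set \<Rightarrow> ('b \<Rightarrow> 'b \<Rightarrow> bool) \<Rightarrow> 'b set \<Rightarrow> (nat \<Rightarrow> 'b) set set" where
  "upow C le U = partitions C le // eqU C le U"

definition upow_less :: "'b set \<Rightarrow> ('b \<Rightarrow> 'b \<Rightarrow> bool) \<Rightarrow> 'b set \<Rightarrow>
    (nat \<Rightarrow> 'b) set \<Rightarrow> (nat \<Rightarrow> 'b) set \<Rightarrow> bool" where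
  "upow_less C le U c d \<longleftrightarrow> (\<exists>n\<in>c. \<exists>m\<in>d. tv_less C le n m \<in> U)"

definition upow_omega :: "'b set \<Rightarrow> ('b \<Rightarrow> 'b \<Rightarrow> bool) \<Rightarrow> 'b set \<Rightarrow> (nat \<Rightarrow> 'b) set set" where
  "upow_omega C le U = {eqU C le U `` {const_part C le k} | k. True}"

definition init_seg :: "'x set \<Rightarrow> ('x \<Rightarrow> 'x \<Rightarrow> bool) \<Rightarrow> 'x set \<Rightarrow> bool" where
  "init_seg X lt I \<longleftrightarrow> I \<subseteq> X \<and> (\<forall>a\<in>I. \<forall>b\<in>X. lt b a \<longrightarrow> b \<in> I)"

definition mu_is :: "'x set \<Rightarrow> ('x \<Rightarrow> 'x \<Rightarrow> bool) \<Rightarrow> 'x set \<Rightarrow> 'm set \<Rightarrow> bool" where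
  "mu_is X lt W M \<longleftrightarrow>
     (\<exists>I. init_seg X lt I \<and> W \<subset> I \<and> card_of I =o card_of M) \<and>
     (\<forall>I. init_seg X lt I \<and> W \<subset> I \<longrightarrow> card_of M \<le>o card_of I)"

definition coinitial_dec_seq :: "'x set \<Rightarrow> ('x \<Rightarrow> 'x \<Rightarrow> bool) \<Rightarrow> 'x set \<Rightarrow> 'i rel \<Rightarrow> ('i \<Rightarrow> 'x) \<Rightarrow> bool" where
  "coinitial_dec_seq X lt W r a \<longleftrightarrow>
     (\<forall>\<alpha>\<in>Field r. a \<alpha> \<in> X - W) \<and>
     (\<forall>\<alpha> \<beta>. (\<alpha>, \<beta>) \<in> r \<and> \<alpha> \<noteq> \<beta> \<longrightarrow> lt (a \<beta>) (a \<alpha>)) \<and>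
     (\<forall>b\<in>X. (\<forall>\<alpha>\<in>Field r. lt b (a \<alpha>)) \<longrightarrow> b \<in> W)"

definition lcf_is :: "'x set \<Rightarrow> ('x \<Rightarrow> 'x \<Rightarrow> bool) \<Rightarrow> 'x set \<Rightarrow> 'l set \<Rightarrow> bool" where
  "lcf_is X lt W Lam \<longleftrightarrow>
     (\<exists>(r :: 'l rel) a. Card_order r \<and> r =o card_of Lam \<and> coinitial_dec_seq X lt W r a) \<and>
     (\<forall>(r :: 'l rel) a. Card_order r \<and> r <o card_of Lam \<longrightarrow> \<not> coinitial_dec_seq X lt W r a)"

definition mu_U_is :: "'b set \<Rightarrow> ('b \<Rightarrow> 'b \<Rightarrow> bool) \<Rightarrow> 'b set \<Rightarrow> 'm set \<Rightarrow> bool" where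
  "mu_U_is C le U M \<longleftrightarrow> mu_is (upow C le U) (upow_less C le U) (upow_omega C le U) M"

definition lcf_U_is :: "'b set \<Rightarrow> ('b \<Rightarrow> 'b \<Rightarrow> bool) \<Rightarrow> 'b set \<Rightarrow> 'l set \<Rightarrow> bool" where
  "lcf_U_is C le U L \<longleftrightarrow> lcf_is (upow C le U) (upow_less C le U) (upow_omega C le U) L"

end

theory Submission
  imports Defs
begin

text \<open>The algebra is the regular open algebra of the finite partial functions from \<open>M \<times> L\<close> to
  \<open>Fpow K \<times> nat\<close>, a notion of forcing isomorphic to the usual one adding \<open>\<mu>\<close> functions into \<open>\<kappa>\<close>.
  It has the \<open>\<kappa>\<^sup>+\<close>-c.c., so it has size at most \<open>\<mu>\<^sup>\<kappa> = \<mu>\<close>, and since \<open>\<kappa> < \<lambda>\<close> with \<open>\<lambda>\<close> regular,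
  every \<open>\<kappa>\<close> of its elements are supported on a proper initial segment of the levels \<open>L\<close>.

  The ultrafilter is built level by level. Given an ultrafilter \<open>V\<close> on the elements supported below \<open>\<alpha>\<close>,
  the columns \<open>(i, \<alpha>)\<close> are independent of \<open>V\<close>. Their \<open>Fpow K\<close>-values give multiplicative refinements of
  all distributions in \<open>V\<close>, and their \<open>nat\<close>-values give \<open>\<mu>\<close> names of numbers; the statements that the
  refinements lie in the ultrafilter, and that these numbers are nonstandard, pairwise different and below all
  nonstandard numbers named by \<open>V\<close>, have the finite intersection property together with \<open>V\<close>. In the end
  every nonstandard element has \<open>\<mu>\<close> elements of some level below it, and choosing one number
  per level gives a coinitial sequence of length \<open>\<lambda>\<close>.\<close>

section \<open>The regular open algebra of a family of conditions\<close>

text \<open>Larger conditions are stronger. The relation is a constant of its own so that the classical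
  reasoner does not unfold inclusions between conditions.\<close>

definition weaker :: "'a set \<Rightarrow> 'a set \<Rightarrow> bool"  (infix \<open>\<preceq>\<close> 50) where
  "p \<preceq> q \<longleftrightarrow> p \<subseteq> q"

lemma weaker_refl [simp, intro]: "p \<preceq> p"
  unfolding weaker_def by simp

lemma weaker_trans: "p \<preceq> q \<Longrightarrow> q \<preceq> r \<Longrightarrow> p \<preceq> r"
  unfolding weaker_def by simp

definition up_closed :: "'a set set \<Rightarrow> 'a set set \<Rightarrow> bool" where
  "up_closed P Y \<longleftrightarrow> (\<forall>p\<in>Y. \<forall>q\<in>P. p \<preceq> q \<longrightarrow> q \<in> Y)"

definition dense_above :: "'a set set \<Rightarrow> 'a set set \<Rightarrow> 'a set \<Rightarrow> bool" where
  "dense_above P Y p \<longleftrightarrow> (\<forall>q\<in>P. p \<preceq> q \<longrightarrow> (\<exists>r\<in>Y. q \<preceq> r))"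

text \<open>In the topology on \<open>P\<close> whose open sets are the up-closed families, this is
  the interior of the closure of an open \<open>Y\<close>: the conditions forcing that the generic
  filter meets \<open>Y\<close>.\<close>

definition reg_closure :: "'a set set \<Rightarrow> 'a set set \<Rightarrow> 'a set set" where
  "reg_closure P Y = {p\<in>P. dense_above P Y p}"

text \<open>The regular open sets. One inclusion is demanded, since an up-closed subset of
  \<open>P\<close> always lies in its regular closure.\<close>

definition RO :: "'a set set \<Rightarrow> 'a set set set" where
  "RO P = {A. A \<subseteq> P \<and> up_closed P A \<and> reg_closure P A \<subseteq> A}"

definition perp :: "'a set set \<Rightarrow> 'a set set \<Rightarrow> 'a set set" where
  "perp P A = {p\<in>P. \<forall>q\<in>A. \<not> p \<preceq> q}"

lemma ROI:
  assumes "A \<subseteq> P" "\<And>p q. p \<in> A \<Longrightarrow> q \<in> P \<Longrightarrow> p \<preceq> q \<Longrightarrow> q \<in> A"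
    and "\<And>p. p \<in> P \<Longrightarrow> p \<notin> A \<Longrightarrow> \<exists>q\<in>P. p \<preceq> q \<and> (\<forall>r\<in>A. \<not> q \<preceq> r)"
  shows "A \<in> RO P"
proof -
  have "reg_closure P A \<subseteq> A"
    unfolding reg_closure_def dense_above_def using assms(3) by (clarsimp, metis)
  moreover have "up_closed P A" unfolding up_closed_def using assms(2) by simp
  ultimately show ?thesis unfolding RO_def using assms(1) by simp
qed

lemma RO_sub: "A \<in> RO P \<Longrightarrow> p \<in> A \<Longrightarrow> p \<in> P"
  unfolding RO_def by blast

lemma RO_up: "A \<in> RO P \<Longrightarrow> p \<in> A \<Longrightarrow> p \<preceq> q \<Longrightarrow> q \<in> P \<Longrightarrow> q \<in> A"
  unfolding RO_def up_closed_def by blast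

lemma RO_dense:
  assumes "A \<in> RO P" "p \<in> P" "\<And>q. q \<in> P \<Longrightarrow> p \<preceq> q \<Longrightarrow> \<exists>r\<in>A. q \<preceq> r"
  shows "p \<in> A"
  using assms unfolding RO_def reg_closure_def dense_above_def by blast

lemma RO_perp: "A \<in> RO P \<Longrightarrow> p \<in> P \<Longrightarrow> p \<notin> A \<Longrightarrow> \<exists>q\<in>perp P A. p \<preceq> q"
  unfolding perp_def using RO_dense[of A P p] by blast

lemma reg_closureI: "p \<in> P \<Longrightarrow> (\<And>q. q \<in> P \<Longrightarrow> p \<preceq> q \<Longrightarrow> \<exists>r\<in>Y. q \<preceq> r) \<Longrightarrow> p \<in> reg_closure P Y"
  unfolding reg_closure_def dense_above_def by simp

lemma reg_closureD: "p \<in> reg_closure P Y \<Longrightarrow> q \<in> P \<Longrightarrow> p \<preceq> q \<Longrightarrow> \<exists>r\<in>Y. q \<preceq> r"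
  unfolding reg_closure_def dense_above_def by simp

lemma reg_closure_sub: "reg_closure P Y \<subseteq> P"
  unfolding reg_closure_def by simp

lemma reg_closure_mono:
  assumes "Y \<subseteq> Z" shows "reg_closure P Y \<subseteq> reg_closure P Z"
proof
  fix p assume p: "p \<in> reg_closure P Y"
  then show "p \<in> reg_closure P Z" using reg_closure_sub[of P Y] reg_closureD[OF p] assms by (intro reg_closureI) blast+
qed

lemma reg_closure_RO:
  assumes "Y \<subseteq> P" "up_closed P Y" shows "reg_closure P Y \<in> RO P"
proof -
  have "up_closed P (reg_closure P Y)"
    unfolding up_closed_def by (auto intro!: reg_closureI dest: reg_closureD weaker_trans)
  moreover have "reg_closure P (reg_closure P Y) \<subseteq> reg_closure P Y"
  proof
    fix p assume p: "p \<in> reg_closure P (reg_closure P Y)"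
    show "p \<in> reg_closure P Y"
    proof (rule reg_closureI)
      show "p \<in> P" using p reg_closure_sub by blast
      fix q assume "q \<in> P" "p \<preceq> q"
      then obtain r where r: "r \<in> reg_closure P Y" "q \<preceq> r" using reg_closureD[OF p] by blast
      then obtain r' where "r' \<in> Y" "r \<preceq> r'" using reg_closureD[OF r(1) _ weaker_refl] reg_closure_sub by blast
      then show "\<exists>r\<in>Y. q \<preceq> r" using r weaker_trans by blast
    qed
  qed
  ultimately show ?thesis unfolding RO_def using reg_closure_sub by simp
qed

lemma reg_closure_upper: "Y \<subseteq> P \<Longrightarrow> up_closed P Y \<Longrightarrow> Y \<subseteq> reg_closure P Y"
  unfolding up_closed_def by (auto intro!: reg_closureI)

lemma reg_closure_least: "Y \<subseteq> A \<Longrightarrow> A \<in> RO P \<Longrightarrow> reg_closure P Y \<subseteq> A"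
proof
  fix p assume "Y \<subseteq> A" "A \<in> RO P" "p \<in> reg_closure P Y"
  then show "p \<in> A" using RO_dense[of A P p] reg_closureD[of p P Y] reg_closure_sub[of P Y] by (meson subsetD)
qed

section \<open>Suprema and infima of regular sets\<close>

lemma up_closed_Union: "S \<subseteq> RO P \<Longrightarrow> up_closed P (\<Union>S)"
  unfolding RO_def up_closed_def by blast

lemma Union_sub: "S \<subseteq> RO P \<Longrightarrow> \<Union>S \<subseteq> P"
  unfolding RO_def by blast

lemma RO_reg_closure: "S \<subseteq> RO P \<Longrightarrow> reg_closure P (\<Union>S) \<in> RO P"
  by (simp add: reg_closure_RO Union_sub up_closed_Union)

lemma is_lub_RO:
  assumes "S \<subseteq> RO P" shows "is_lub (RO P) (\<subseteq>) S (reg_closure P (\<Union>S))"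
  unfolding is_lub_def
proof (intro conjI ballI impI)
  show "reg_closure P (\<Union>S) \<in> RO P" using assms by (rule RO_reg_closure)
  show "s \<subseteq> reg_closure P (\<Union>S)" if "s \<in> S" for s
    using reg_closure_upper[OF Union_sub up_closed_Union] assms that by blast
  show "reg_closure P (\<Union>S) \<subseteq> y" if "y \<in> RO P" "\<forall>s\<in>S. s \<subseteq> y" for y
    using that by (intro reg_closure_least) auto
qed

lemma RO_Inter:
  assumes "S \<subseteq> RO P" shows "P \<inter> \<Inter>S \<in> RO P"
proof (rule ROI)
  fix p assume p: "p \<in> P" "p \<notin> P \<inter> \<Inter>S"
  then obtain A where A: "A \<in> S" "A \<in> RO P" "p \<notin> A" using assms by blast
  then obtain q where "q \<in> P" "p \<preceq> q" "\<forall>r\<in>A. \<not> q \<preceq> r" using RO_dense[of A P p] p(1) by metis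
  then show "\<exists>q\<in>P. p \<preceq> q \<and> (\<forall>r\<in>P \<inter> \<Inter>S. \<not> q \<preceq> r)" using A(1) by blast
qed (use assms RO_up in blast)+

lemma is_glb_RO: "S \<subseteq> RO P \<Longrightarrow> is_glb (RO P) (\<subseteq>) S (P \<inter> \<Inter>S)"
  unfolding is_glb_def using RO_Inter RO_sub by auto

lemma is_lub_unique: "is_lub C (\<subseteq>) S x \<Longrightarrow> is_lub C (\<subseteq>) S y \<Longrightarrow> x = y"
  unfolding is_lub_def by (rule subset_antisym) simp_all

lemma is_glb_unique: "is_glb C (\<subseteq>) S x \<Longrightarrow> is_glb C (\<subseteq>) S y \<Longrightarrow> x = y"
  unfolding is_glb_def by (rule subset_antisym) simp_all

lemma bsup_RO: "S \<subseteq> RO P \<Longrightarrow> bsup (RO P) (\<subseteq>) S = reg_closure P (\<Union>S)"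
  unfolding bsup_def by (rule the_equality) (erule is_lub_RO, erule is_lub_unique, erule is_lub_RO)

lemma binf_RO: "S \<subseteq> RO P \<Longrightarrow> binf (RO P) (\<subseteq>) S = P \<inter> \<Inter>S"
  unfolding binf_def by (rule the_equality) (erule is_glb_RO, erule is_glb_unique, erule is_glb_RO)

lemma RO_Int: assumes "A \<in> RO P" "B \<in> RO P" shows "A \<inter> B \<in> RO P"
proof -
  have "P \<inter> \<Inter>{A,B} = A \<inter> B" using RO_sub[OF assms(1)] by auto
  then show ?thesis using RO_Inter[of "{A,B}" P] assms by simp
qed

lemma RO_P: "P \<in> RO P"
  using RO_Inter[of "{}" P] by simp

lemma RO_empty: "{} \<in> RO P"
  by (rule ROI) auto

lemma bmeet_RO: assumes "A \<in> RO P" "B \<in> RO P" shows "bmeet (RO P) (\<subseteq>) A B = A \<inter> B"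
proof -
  have "P \<inter> \<Inter>{A,B} = A \<inter> B" using RO_sub[OF assms(1)] by auto
  then show ?thesis unfolding bmeet_def using binf_RO[of "{A,B}" P] assms by simp
qed

lemma bjoin_RO: "A \<in> RO P \<Longrightarrow> B \<in> RO P \<Longrightarrow> bjoin (RO P) (\<subseteq>) A B = reg_closure P (A \<union> B)"
  unfolding bjoin_def using bsup_RO[of "{A,B}" P] by simp

lemma bzero_RO: "bzero (RO P) (\<subseteq>) = {}"
  unfolding bzero_def using bsup_RO[of "{}" P] reg_closureD[OF _ _ weaker_refl, of _ P "{}"] reg_closure_sub[of P "{}"] by auto

lemma bone_RO: "bone (RO P) (\<subseteq>) = P"
  unfolding bone_def using binf_RO[of "{}" P] by auto

section \<open>Complements and distributivity\<close>

lemma perpI: "p \<in> P \<Longrightarrow> (\<And>q. q \<in> A \<Longrightarrow> p \<preceq> q \<Longrightarrow> False) \<Longrightarrow> p \<in> perp P A"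
  unfolding perp_def by blast

lemma perpD: "p \<in> perp P A \<Longrightarrow> q \<in> A \<Longrightarrow> \<not> p \<preceq> q"
  unfolding perp_def by blast

lemma perp_sub: "perp P A \<subseteq> P"
  unfolding perp_def by blast

lemma perp_RO: "A \<in> RO P \<Longrightarrow> perp P A \<in> RO P"
proof (rule ROI)
  fix p q assume "p \<in> perp P A" "q \<in> P" "p \<preceq> q"
  then show "q \<in> perp P A" by (meson perpI perpD weaker_trans)
next
  fix p assume "A \<in> RO P" "p \<in> P" "p \<notin> perp P A"
  then obtain q where "q \<in> A" "p \<preceq> q" by (meson perpI)
  moreover have "\<not> q \<preceq> r" if "r \<in> perp P A" for r
    using that \<open>A \<in> RO P\<close> \<open>q \<in> A\<close> RO_up[of A P q r] perp_sub[of P A] perpD[OF that, of r] by blast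
  ultimately show "\<exists>q\<in>P. p \<preceq> q \<and> (\<forall>r\<in>perp P A. \<not> q \<preceq> r)"
    using RO_sub[OF \<open>A \<in> RO P\<close>] by blast
qed (rule perp_sub)

lemma perp_disj: "A \<inter> perp P A = {}"
  unfolding perp_def by blast

lemma perp_dense:
  assumes "A \<in> RO P" shows "reg_closure P (A \<union> perp P A) = P"
proof
  show "P \<subseteq> reg_closure P (A \<union> perp P A)"
    using RO_perp[OF assms] by (fastforce intro: reg_closureI)
qed (rule reg_closure_sub)

text \<open>\<open>bcompl\<close> is a definite description, so evaluating it needs uniqueness.
  Disjointness puts the up-closed \<open>B\<close> inside the complement; conversely, above any
  \<open>p\<close> in \<open>perp P A\<close> the set \<open>A \<union> B\<close> is dense and
  \<open>A\<close> is absent, so regularity puts \<open>p\<close> into \<open>B\<close>.\<close>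

lemma perp_unique:
  assumes "A \<in> RO P" "B \<in> RO P" "A \<inter> B = {}" "reg_closure P (A \<union> B) = P"
  shows "B = perp P A"
proof
  show "B \<subseteq> perp P A"
  proof
    fix p assume "p \<in> B"
    then show "p \<in> perp P A"
      using assms(3) RO_up[OF assms(2), of p] RO_sub[OF assms(1)] RO_sub[OF assms(2)]
      by (intro perpI) blast+
  qed
  show "perp P A \<subseteq> B"
  proof
    fix p assume p: "p \<in> perp P A"
    show "p \<in> B"
    proof (rule RO_dense[OF assms(2)])
      show "p \<in> P" using p perp_sub by blast
      then have "p \<in> reg_closure P (A \<union> B)" using assms(4) by simp
      fix q assume q: "q \<in> P" "p \<preceq> q"
      then obtain r where r: "r \<in> A \<union> B" "q \<preceq> r" using reg_closureD[OF \<open>p \<in> reg_closure P (A \<union> B)\<close>] by blast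
      then have "r \<notin> A" using perpD[OF p] q weaker_trans by blast
      then show "\<exists>r\<in>B. q \<preceq> r" using r by blast
    qed
  qed
qed

lemma bcompl_RO:
  assumes A: "A \<in> RO P" shows "bcompl (RO P) (\<subseteq>) A = perp P A"
  unfolding bcompl_def
proof (rule the_equality)
  fix b assume "b \<in> RO P \<and> bmeet (RO P) (\<subseteq>) A b = bzero (RO P) (\<subseteq>)
    \<and> bjoin (RO P) (\<subseteq>) A b = bone (RO P) (\<subseteq>)"
  then show "b = perp P A" using A
    by (intro perp_unique) (auto simp: bmeet_RO bjoin_RO bone_RO bzero_RO)
qed (use A in \<open>simp add: perp_RO bmeet_RO bjoin_RO bone_RO bzero_RO perp_disj perp_dense\<close>)

text \<open>A regular set is up-closed, so a member of \<open>Y\<close> found above a condition in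
  \<open>A\<close> is again in \<open>A\<close>. With \<open>Y\<close> a union of two regular sets
  this is the distributive law.\<close>

lemma Int_reg_closure:
  assumes A: "A \<in> RO P" and Y: "Y \<subseteq> P" "up_closed P Y" shows "A \<inter> reg_closure P Y = reg_closure P (A \<inter> Y)"
proof
  show "A \<inter> reg_closure P Y \<subseteq> reg_closure P (A \<inter> Y)"
  proof
    fix p assume p: "p \<in> A \<inter> reg_closure P Y"
    show "p \<in> reg_closure P (A \<inter> Y)"
    proof (rule reg_closureI)
      show "p \<in> P" using p reg_closure_sub by blast
      fix q assume q: "q \<in> P" "p \<preceq> q"
      obtain r where r: "r \<in> Y" "q \<preceq> r" using reg_closureD[of p P Y q] p q by blast
      then have "p \<preceq> r" "r \<in> P" using q weaker_trans Y(1) by blast+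
      then have "r \<in> A" using RO_up[OF A] p by blast
      then show "\<exists>r\<in>A \<inter> Y. q \<preceq> r" using r by blast
    qed
  qed
  have "reg_closure P (A \<inter> Y) \<subseteq> reg_closure P Y" by (rule reg_closure_mono) simp
  then show "reg_closure P (A \<inter> Y) \<subseteq> A \<inter> reg_closure P Y"
    using reg_closure_least[of "A \<inter> Y" A P] A by simp
qed

lemma complete_BA_RO: "complete_BA (RO P) (\<subseteq>)"
proof -
  have distr: "bmeet (RO P) (\<subseteq>) a (bjoin (RO P) (\<subseteq>) b c)
      = bjoin (RO P) (\<subseteq>) (bmeet (RO P) (\<subseteq>) a b) (bmeet (RO P) (\<subseteq>) a c)"
    if "a \<in> RO P" "b \<in> RO P" "c \<in> RO P" for a b c
  proof -
    have "up_closed P (b \<union> c)" "b \<union> c \<subseteq> P" using up_closed_Union[of "{b,c}" P] Union_sub[of "{b,c}" P] that by auto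
    then show ?thesis using that reg_closure_RO[of "b \<union> c" P] Int_reg_closure[of a P "b \<union> c"]
      by (simp add: bjoin_RO bmeet_RO RO_Int Int_Un_distrib)
  qed
  have "\<exists>b\<in>RO P. bmeet (RO P) (\<subseteq>) a b = bzero (RO P) (\<subseteq>) \<and> bjoin (RO P) (\<subseteq>) a b = bone (RO P) (\<subseteq>)"
    if "a \<in> RO P" for a
    using that by (intro bexI[of _ "perp P a"])
      (auto simp: perp_RO bmeet_RO bjoin_RO bone_RO bzero_RO perp_disj perp_dense)
  moreover have "\<exists>x. is_lub (RO P) (\<subseteq>) S x" "\<exists>x. is_glb (RO P) (\<subseteq>) S x" if "S \<subseteq> RO P" for S
    using is_lub_RO[OF that] is_glb_RO[OF that] by blast+
  ultimately show ?thesis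
    unfolding complete_BA_def using distr by (auto simp only: order_refl subset_antisym dest: order_trans)
qed

section \<open>Ultrafilters\<close>

definition pfilter :: "'a set set \<Rightarrow> 'a set set set \<Rightarrow> bool" where
  "pfilter P F \<longleftrightarrow> (\<forall>a\<in>F. a \<in> RO P) \<and> P \<in> F \<and> {} \<notin> F \<and> (\<forall>a\<in>F. \<forall>b\<in>F. a \<inter> b \<in> F)
     \<and> (\<forall>a\<in>F. \<forall>b\<in>RO P. a \<subseteq> b \<longrightarrow> b \<in> F)"

definition ultra :: "'a set set \<Rightarrow> 'a set set set \<Rightarrow> bool" where
  "ultra P U \<longleftrightarrow> pfilter P U \<and> (\<forall>a\<in>RO P. a \<in> U \<or> perp P a \<in> U)"

lemma pfilterI:
  assumes "\<And>a. a \<in> F \<Longrightarrow> a \<in> RO P" "P \<in> F" "{} \<notin> F" "\<And>a b. a \<in> F \<Longrightarrow> b \<in> F \<Longrightarrow> a \<inter> b \<in> F"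
    "\<And>a b. a \<in> F \<Longrightarrow> b \<in> RO P \<Longrightarrow> a \<subseteq> b \<Longrightarrow> b \<in> F"
  shows "pfilter P F"
  unfolding pfilter_def by (intro conjI ballI impI) (rule assms; assumption)+

lemma pfilterD:
  assumes "pfilter P F"
  shows "\<And>a. a \<in> F \<Longrightarrow> a \<in> RO P" "P \<in> F" "{} \<notin> F" "\<And>a b. a \<in> F \<Longrightarrow> b \<in> F \<Longrightarrow> a \<inter> b \<in> F"
    "\<And>a b. a \<in> F \<Longrightarrow> b \<in> RO P \<Longrightarrow> a \<subseteq> b \<Longrightarrow> b \<in> F"
  using assms unfolding pfilter_def by metis+

lemma ultra_sub: "ultra P U \<Longrightarrow> a \<in> U \<Longrightarrow> a \<in> RO P"
  unfolding ultra_def using pfilterD(1) by blast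

lemma ultra_P: "ultra P U \<Longrightarrow> P \<in> U"
  unfolding ultra_def using pfilterD(2) by blast

lemma ultra_empty: "ultra P U \<Longrightarrow> {} \<notin> U"
  unfolding ultra_def using pfilterD(3) by blast

lemma ultra_Int: "ultra P U \<Longrightarrow> a \<in> U \<Longrightarrow> b \<in> U \<Longrightarrow> a \<inter> b \<in> U"
  unfolding ultra_def using pfilterD(4) by blast

lemma ultra_up: "ultra P U \<Longrightarrow> a \<in> U \<Longrightarrow> a \<subseteq> b \<Longrightarrow> b \<in> RO P \<Longrightarrow> b \<in> U"
  unfolding ultra_def using pfilterD(5)[of P U a b] by (elim conjE)

lemma ultra_perp: "ultra P U \<Longrightarrow> a \<in> RO P \<Longrightarrow> perp P a \<in> U \<longleftrightarrow> a \<notin> U"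
  using perp_disj[of a P] ultra_Int[of P U a "perp P a"] ultra_empty[of P U] unfolding ultra_def by auto

lemma BA_ultrafilter_RO:
  assumes U: "ultra P U" shows "BA_ultrafilter (RO P) (\<subseteq>) U"
  unfolding BA_ultrafilter_def bone_RO bzero_RO
proof (intro conjI ballI impI)
  fix a assume "a \<in> RO P"
  then show "a \<in> U \<or> bcompl (RO P) (\<subseteq>) a \<in> U" using ultra_perp[OF U] bcompl_RO by metis
next
  fix a b assume "a \<in> U" "b \<in> U"
  then show "bmeet (RO P) (\<subseteq>) a b \<in> U" using ultra_Int[OF U] ultra_sub[OF U] bmeet_RO by metis
next
  show "U \<subseteq> RO P" using ultra_sub[OF U] by (rule subsetI)
qed (fact ultra_P[OF U] ultra_empty[OF U] | rule ultra_up[OF U], assumption+)+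

lemma filter_base_pfilter:
  assumes "S \<subseteq> RO P" "S \<noteq> {}" "{} \<notin> S" "\<And>a b. a \<in> S \<Longrightarrow> b \<in> S \<Longrightarrow> \<exists>c\<in>S. c \<subseteq> a \<inter> b"
  shows "pfilter P {b\<in>RO P. \<exists>a\<in>S. a \<subseteq> b}"
proof (rule pfilterI)
  obtain a where "a \<in> S" "a \<in> RO P" using assms(1,2) by blast
  then show "P \<in> {b \<in> RO P. \<exists>a\<in>S. a \<subseteq> b}" using RO_P[of P] RO_sub[of a P] by blast
  show "{} \<notin> {b \<in> RO P. \<exists>a\<in>S. a \<subseteq> b}" using assms(3) by simp
  fix a assume a: "a \<in> {b \<in> RO P. \<exists>a\<in>S. a \<subseteq> b}"
  then show "a \<in> RO P" by simp
  obtain a' where a': "a' \<in> S" "a' \<subseteq> a" using a by auto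
  { fix b assume b: "b \<in> {b \<in> RO P. \<exists>a\<in>S. a \<subseteq> b}"
    then obtain b' where b': "b' \<in> S" "b' \<subseteq> b" by auto
    obtain c where "c \<in> S" "c \<subseteq> a' \<inter> b'" using assms(4) a' b' by blast
    then have "c \<subseteq> a \<inter> b" using a' b' by blast
    then show "a \<inter> b \<in> {b \<in> RO P. \<exists>a\<in>S. a \<subseteq> b}" using RO_Int[of a P b] a b \<open>c \<in> S\<close> by auto }
  fix b assume "b \<in> RO P" "a \<subseteq> b"
  then show "b \<in> {b \<in> RO P. \<exists>a\<in>S. a \<subseteq> b}" using a' order_trans by blast
qed

text \<open>Zorn's lemma gives a maximal proper filter. If some member of it misses
  \<open>a\<close>, that member lies inside \<open>perp P a\<close>; otherwise the traces of its
  members on \<open>a\<close> generate a proper filter that contains it and \<open>a\<close>, and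
  maximality puts \<open>a\<close> into it.\<close>

lemma pfilter_ultra:
  assumes "pfilter P F"
  shows "\<exists>U. ultra P U \<and> F \<subseteq> U"
proof -
  let ?Z = "{G. pfilter P G \<and> F \<subseteq> G}"
  have "\<exists>M\<in>?Z. \<forall>X\<in>?Z. M \<subseteq> X \<longrightarrow> X = M"
  proof (rule subset_Zorn)
    fix c assume "subset.chain ?Z c"
    then have c: "c \<subseteq> ?Z" "\<And>x y. x \<in> c \<Longrightarrow> y \<in> c \<Longrightarrow> x \<subseteq> y \<or> y \<subseteq> x"
      unfolding subset.chain_def by (simp_all, metis order.strict_implies_order order_refl)
    then have cf: "pfilter P x" "F \<subseteq> x" if "x \<in> c" for x using that by (simp_all add: subset_eq)
    show "\<exists>u\<in>?Z. \<forall>x\<in>c. x \<subseteq> u"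
    proof (cases "c = {}")
      case True then show ?thesis using assms by simp (meson order_refl)
    next
      case False
      then obtain x0 where x0: "x0 \<in> c" by blast
      have "pfilter P (\<Union>c)"
      proof (rule pfilterI)
        show "P \<in> \<Union>c" using pfilterD(2)[OF cf(1)] x0 by blast
        show "{} \<notin> \<Union>c" using pfilterD(3)[OF cf(1)] by blast
        fix a assume "a \<in> \<Union>c"
        then obtain x where x: "x \<in> c" "a \<in> x" by blast
        then show "a \<in> RO P" using pfilterD(1)[OF cf(1)] by blast
        { fix b assume "b \<in> \<Union>c"
          then obtain y where "y \<in> c" "b \<in> y" by blast
          then obtain z where "z \<in> c" "a \<in> z" "b \<in> z" using c(2)[of x y] x by blast
          then show "a \<inter> b \<in> \<Union>c" using pfilterD(4)[OF cf(1)] by blast }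
        fix b assume "b \<in> RO P" "a \<subseteq> b"
        then have "b \<in> x" using x pfilterD(5)[OF cf(1)] by metis
        then show "b \<in> \<Union>c" using x by blast
      qed
      moreover have "F \<subseteq> \<Union>c" using cf(2)[OF x0] x0 by blast
      moreover have "\<forall>x\<in>c. x \<subseteq> \<Union>c" by blast
      ultimately show ?thesis by (intro bexI[of _ "\<Union>c"]) simp_all
    qed
  qed
  then obtain U where U: "pfilter P U" "F \<subseteq> U"
    and max: "\<And>X. pfilter P X \<Longrightarrow> U \<subseteq> X \<Longrightarrow> X = U"
    by simp (meson order_trans)
  have "a \<in> U \<or> perp P a \<in> U" if a: "a \<in> RO P" for a
  proof (cases "\<exists>b\<in>U. b \<inter> a = {}")
    case True
    then obtain b where b: "b \<in> U" "b \<inter> a = {}" by blast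
    have bR: "b \<in> RO P" using pfilterD(1)[OF U(1) b(1)] .
    have "b \<subseteq> perp P a"
    proof
      fix p assume "p \<in> b"
      then show "p \<in> perp P a" using b(2) RO_up[OF bR, of p] RO_sub[OF bR] RO_sub[OF a]
        by (intro perpI) blast+
    qed
    then show ?thesis using pfilterD(5)[OF U(1) b(1) perp_RO[OF a]] by blast
  next
    case False
    let ?S = "(\<lambda>b. b \<inter> a) ` U"
    let ?F = "{b\<in>RO P. \<exists>x\<in>?S. x \<subseteq> b}"
    have "pfilter P ?F"
    proof (rule filter_base_pfilter)
      show "?S \<subseteq> RO P" using RO_Int[OF pfilterD(1)[OF U(1)] a] by blast
      show "?S \<noteq> {}" using pfilterD(2)[OF U(1)] by blast
      show "{} \<notin> ?S" using False by (metis imageE)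
      fix x y assume "x \<in> ?S" "y \<in> ?S"
      then obtain b b' where b: "b \<in> U" "b' \<in> U" "x = b \<inter> a" "y = b' \<inter> a" by blast
      then have "b \<inter> b' \<in> U" using pfilterD(4)[OF U(1)] by blast
      moreover have "(b \<inter> b') \<inter> a \<subseteq> x \<inter> y" using b by blast
      ultimately show "\<exists>z\<in>?S. z \<subseteq> x \<inter> y" by blast
    qed
    moreover have "U \<subseteq> ?F"
    proof
      fix b assume "b \<in> U"
      then show "b \<in> ?F" using pfilterD(1)[OF U(1)] by auto
    qed
    ultimately have "?F = U" by (rule max)
    moreover have "a \<in> ?F" using pfilterD(2)[OF U(1)] a by auto
    ultimately have "a \<in> U" by simp
    then show ?thesis ..
  qed
  with U show ?thesis unfolding ultra_def by blast
qed

section \<open>Truth values in the Boolean power\<close>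

text \<open>The names of natural numbers: \<open>p\<close> in \<open>n i\<close> means that
  \<open>p\<close> forces the value \<open>i\<close>. That the join is the unit is stated as density
  of the conditions deciding the value.\<close>

definition parts :: "'a set set \<Rightarrow> (nat \<Rightarrow> 'a set set) set" where
  "parts P = {n. (\<forall>i. n i \<in> RO P) \<and> (\<forall>i j. i \<noteq> j \<longrightarrow> n i \<inter> n j = {})
      \<and> (\<forall>p\<in>P. \<exists>q\<in>P. p \<preceq> q \<and> (\<exists>i. q \<in> n i))}"

text \<open>The conditions forcing \<open>R\<close> between the two named numbers. A general
  \<open>R\<close> covers equality and order at once and, with the same name taken twice, also
  properties of a single number.\<close>

definition tv :: "'a set set \<Rightarrow> (nat \<Rightarrow> nat \<Rightarrow> bool) \<Rightarrow> (nat \<Rightarrow> 'a set set) \<Rightarrow> (nat \<Rightarrow> 'a set set) \<Rightarrow> 'a set set" where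
  "tv P R n m = {p\<in>P. \<forall>q\<in>P. p \<preceq> q \<longrightarrow> (\<forall>i j. q \<in> n i \<longrightarrow> q \<in> m j \<longrightarrow> R i j)}"

lemma partitions_RO: "partitions (RO P) (\<subseteq>) = parts P"
proof -
  have "bsup (RO P) (\<subseteq>) (range n) = P \<longleftrightarrow> (\<forall>p\<in>P. \<exists>q\<in>P. p \<preceq> q \<and> (\<exists>i. q \<in> n i))"
    if n: "\<forall>i. n i \<in> RO P" for n :: "nat \<Rightarrow> 'a set set"
  proof -
    have "range n \<subseteq> RO P" using n by blast
    then have *: "bsup (RO P) (\<subseteq>) (range n) = reg_closure P (\<Union>(range n))" by (rule bsup_RO)
    have np: "q \<in> P" if "q \<in> n i" for q i using RO_sub that n by metis
    show ?thesis unfolding *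
    proof
      assume **: "reg_closure P (\<Union>(range n)) = P"
      show "\<forall>p\<in>P. \<exists>q\<in>P. p \<preceq> q \<and> (\<exists>i. q \<in> n i)"
      proof
        fix p assume "p \<in> P"
        then have "\<exists>r\<in>\<Union>(range n). p \<preceq> r" using ** reg_closureD[of p P "\<Union>(range n)" p] by simp
        then show "\<exists>q\<in>P. p \<preceq> q \<and> (\<exists>i. q \<in> n i)" using np by (metis UN_E)
      qed
    next
      assume "\<forall>p\<in>P. \<exists>q\<in>P. p \<preceq> q \<and> (\<exists>i. q \<in> n i)"
      then have "P \<subseteq> reg_closure P (\<Union>(range n))" by (intro subsetI reg_closureI) (assumption, metis UN_I UNIV_I)
      then show "reg_closure P (\<Union>(range n)) = P" using reg_closure_sub by (metis subset_antisym)
    qed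
  qed
  then show ?thesis unfolding partitions_def parts_def
    by (intro Collect_cong) (simp add: bone_RO bzero_RO bmeet_RO cong: conj_cong)
qed

lemma parts_RO: "n \<in> parts P \<Longrightarrow> n i \<in> RO P"
  unfolding parts_def by blast

lemma parts_uniq: "n \<in> parts P \<Longrightarrow> p \<in> n i \<Longrightarrow> p \<in> n j \<Longrightarrow> i = j"
  unfolding parts_def by blast

lemma parts_ext: "n \<in> parts P \<Longrightarrow> p \<in> P \<Longrightarrow> \<exists>q i. q \<in> P \<and> p \<preceq> q \<and> q \<in> n i"
  unfolding parts_def by blast

lemma parts_up: "n \<in> parts P \<Longrightarrow> p \<in> n i \<Longrightarrow> p \<preceq> q \<Longrightarrow> q \<in> P \<Longrightarrow> q \<in> n i"
  using RO_up parts_RO by blast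

lemma parts_ext2:
  assumes "n \<in> parts P" "m \<in> parts P" "p \<in> P"
  shows "\<exists>q i j. q \<in> P \<and> p \<preceq> q \<and> q \<in> n i \<and> q \<in> m j"
proof -
  obtain q i where q: "q \<in> P" "p \<preceq> q" "q \<in> n i" using parts_ext[OF assms(1,3)] by blast
  moreover obtain r j where "r \<in> P" "q \<preceq> r" "r \<in> m j" using parts_ext[OF assms(2) q(1)] by blast
  moreover have "r \<in> n i" using parts_up[OF assms(1)] calculation by blast
  moreover have "p \<preceq> r" using calculation weaker_trans by blast
  ultimately show ?thesis by blast
qed

lemma tvI: "p \<in> P \<Longrightarrow> (\<And>q i j. q \<in> P \<Longrightarrow> p \<preceq> q \<Longrightarrow> q \<in> n i \<Longrightarrow> q \<in> m j \<Longrightarrow> R i j) \<Longrightarrow> p \<in> tv P R n m"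
  unfolding tv_def by simp

lemma tvD: "p \<in> tv P R n m \<Longrightarrow> q \<in> P \<Longrightarrow> p \<preceq> q \<Longrightarrow> q \<in> n i \<Longrightarrow> q \<in> m j \<Longrightarrow> R i j"
  unfolding tv_def by simp

lemma tv_sub: "tv P R n m \<subseteq> P"
  unfolding tv_def by simp

text \<open>Conditions deciding both names are dense, and decided values are unique and persist to
  extensions. So forcing \<open>R\<close> amounts to lying in the join of the meets
  \<open>n i \<inter> m j\<close> with \<open>R i j\<close>, the form in which the Boolean truth
  values are defined.\<close>

lemma tv_eq_reg_closure:
  assumes "n \<in> parts P" "m \<in> parts P"
  shows "tv P R n m = reg_closure P (\<Union>{n i \<inter> m j | i j. R i j})"
proof
  show "tv P R n m \<subseteq> reg_closure P (\<Union>{n i \<inter> m j | i j. R i j})"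
  proof
    fix p assume p: "p \<in> tv P R n m"
    { fix q assume q: "q \<in> P" "p \<preceq> q"
      then obtain r i j where r: "r \<in> P" "q \<preceq> r" "r \<in> n i" "r \<in> m j" using parts_ext2[OF assms] by blast
      then have "R i j" using tvD[OF p] q weaker_trans by blast
      then have "\<exists>r\<in>\<Union>{n i \<inter> m j | i j. R i j}. q \<preceq> r" using r by blast }
    then show "p \<in> reg_closure P (\<Union>{n i \<inter> m j | i j. R i j})"
      using p unfolding reg_closure_def dense_above_def tv_def by blast
  qed
  show "reg_closure P (\<Union>{n i \<inter> m j | i j. R i j}) \<subseteq> tv P R n m"
  proof
    fix p assume p: "p \<in> reg_closure P (\<Union>{n i \<inter> m j | i j. R i j})"
    show "p \<in> tv P R n m"
    proof (rule tvI)
      show "p \<in> P" using p reg_closure_sub by blast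
      fix q i j assume q: "q \<in> P" "p \<preceq> q" "q \<in> n i" "q \<in> m j"
      then obtain r i' j' where r: "r \<in> n i'" "r \<in> m j'" "R i' j'" "q \<preceq> r"
        using reg_closureD[OF p] by blast
      have "r \<in> P" using RO_sub[OF parts_RO[OF assms(1)] r(1)] .
      then have "r \<in> n i" "r \<in> m j" using q r parts_up[OF assms(1)] parts_up[OF assms(2)] by blast+
      then have "i = i'" "j = j'" using r parts_uniq[OF assms(1)] parts_uniq[OF assms(2)] by blast+
      then show "R i j" using r by blast
    qed
  qed
qed

lemma tv_RO: "n \<in> parts P \<Longrightarrow> m \<in> parts P \<Longrightarrow> tv P R n m \<in> RO P"
  unfolding tv_eq_reg_closure by (rule RO_reg_closure) (auto simp: RO_Int parts_RO)

lemma tv_less_RO: "n \<in> parts P \<Longrightarrow> m \<in> parts P \<Longrightarrow> tv_less (RO P) (\<subseteq>) n m = tv P (<) n m"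
proof -
  assume nm: "n \<in> parts P" "m \<in> parts P"
  have *: "{bmeet (RO P) (\<subseteq>) (n i) (m j) | i j. i < j} = {n i \<inter> m j | i j. i < j}"
    using nm by (auto simp: bmeet_RO parts_RO)
  show ?thesis unfolding tv_less_def * tv_eq_reg_closure[OF nm]
    by (rule bsup_RO) (use nm in \<open>auto simp: RO_Int parts_RO\<close>)
qed

lemma tv_eq_RO: "n \<in> parts P \<Longrightarrow> m \<in> parts P \<Longrightarrow> tv_eq (RO P) (\<subseteq>) n m = tv P (=) n m"
proof -
  assume nm: "n \<in> parts P" "m \<in> parts P"
  have *: "{bmeet (RO P) (\<subseteq>) (n i) (m i) | i. True} = {n i \<inter> m j | i j. i = j}"
    using nm by (auto simp: bmeet_RO parts_RO)
  show ?thesis unfolding tv_eq_def * tv_eq_reg_closure[OF nm]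
    by (rule bsup_RO) (use nm in \<open>auto simp: RO_Int parts_RO\<close>)
qed

lemma tv_trans:
  assumes "m \<in> parts P" "n \<in> parts P" "l \<in> parts P" "\<And>i j k. R i j \<Longrightarrow> S j k \<Longrightarrow> T i k"
  shows "tv P R n m \<inter> tv P S m l \<subseteq> tv P T n l"
proof
  fix p assume p: "p \<in> tv P R n m \<inter> tv P S m l"
  show "p \<in> tv P T n l"
  proof (rule tvI)
    show "p \<in> P" using p tv_sub by blast
    fix q i k assume q: "q \<in> P" "p \<preceq> q" "q \<in> n i" "q \<in> l k"
    \<comment> \<open>The condition \<open>q\<close> may leave the middle name undecided, hence the
      extension \<open>r\<close>.\<close>
    obtain r j where r: "r \<in> P" "q \<preceq> r" "r \<in> m j" using parts_ext[OF assms(1) q(1)] by blast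
    then have "r \<in> n i" "r \<in> l k" "p \<preceq> r"
      using q parts_up[OF assms(2)] parts_up[OF assms(3)] weaker_trans by blast+
    then show "T i k" using tvD[of p P R n m r i j] tvD[of p P S m l r j k] p r assms(4) by blast
  qed
qed

lemma ultra_tv_trans:
  assumes "ultra P U" "tv P R n m \<in> U" "tv P S m l \<in> U"
    and "m \<in> parts P" "n \<in> parts P" "l \<in> parts P" "\<And>i j k. R i j \<Longrightarrow> S j k \<Longrightarrow> T i k"
  shows "tv P T n l \<in> U"
  using ultra_up[OF assms(1) ultra_Int[OF assms(1-3)] tv_trans tv_RO] assms by blast

lemma tv_eq_sym: "tv P (=) n m = tv P (=) m n"
  unfolding tv_def by blast

lemma tv_refl: "n \<in> parts P \<Longrightarrow> tv P (=) n n = P"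
  unfolding tv_def using parts_uniq by blast

definition const_name :: "'a set set \<Rightarrow> nat \<Rightarrow> nat \<Rightarrow> 'a set set" where
  "const_name P k = (\<lambda>i. if i = k then P else {})"

lemma const_part_RO: "const_part (RO P) (\<subseteq>) = const_name P"
  by (intro ext) (simp add: const_part_def const_name_def bone_RO bzero_RO)

lemma const_name_parts: "const_name P k \<in> parts P"
  unfolding parts_def const_name_def by (auto simp: RO_P RO_empty)

lemma tv_const_name: "n \<in> parts P \<Longrightarrow> tv P (=) n (const_name P k) = n k"
proof -
  assume n: "n \<in> parts P"
  have "\<Union>{n i \<inter> const_name P k j | i j. i = j} = n k"
    using RO_sub[OF parts_RO[OF n]] by (auto simp: const_name_def)
  moreover have "reg_closure P (n k) = n k"
    using reg_closure_upper[of "n k" P] reg_closure_least[OF _ parts_RO[OF n, of k]] parts_RO[OF n, of k]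
    unfolding RO_def by blast
  ultimately show ?thesis unfolding tv_eq_reg_closure[OF n const_name_parts] by simp
qed

text \<open>Equality with the constant \<open>k\<close> has truth value \<open>n k\<close>, so this
  says that the class of \<open>n\<close> is none of the standard numbers.\<close>

definition nonstd :: "'a set set set \<Rightarrow> (nat \<Rightarrow> 'a set set) \<Rightarrow> bool" where
  "nonstd U n \<longleftrightarrow> (\<forall>k. n k \<notin> U)"

text \<open>The complement of each \<open>n k\<close> is in \<open>U\<close>, so the values from
  \<open>0\<close> up to \<open>k\<close> can be excluded one at a time, and finite intersections
  stay in \<open>U\<close>.\<close>

lemma nonstd_gt:
  assumes U: "ultra P U" and n: "n \<in> parts P" and "nonstd U n"
  shows "tv P (\<lambda>i j. k < i) n n \<in> U"
proof -
  have "tv P (\<lambda>i j. k \<le> i) n n \<in> U" for k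
  proof (induction k)
    case 0
    have "tv P (\<lambda>i j. 0 \<le> i) n n = P" unfolding tv_def by blast
    then show ?case using ultra_P[OF U] by simp
  next
    case (Suc k)
    have "perp P (n k) \<in> U" using assms(3) ultra_perp[OF U parts_RO[OF n]] unfolding nonstd_def by blast
    moreover have "tv P (\<lambda>i j. k \<le> i) n n \<inter> perp P (n k) \<subseteq> tv P (\<lambda>i j. Suc k \<le> i) n n"
      unfolding tv_def perp_def by (force simp: Suc_le_eq order.strict_iff_order)
    ultimately show ?case using ultra_up[OF U ultra_Int[OF U Suc]] tv_RO[OF n n] by blast
  qed
  from this[of "Suc k"] show ?thesis by (simp add: Suc_le_eq)
qed

section \<open>The Boolean power modulo an ultrafilter\<close>

abbreviation "cls P U n \<equiv> eqU (RO P) (\<subseteq>) U `` {n}"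
abbreviation "upw P U \<equiv> upow (RO P) (\<subseteq>) U"
abbreviation "upl P U \<equiv> upow_less (RO P) (\<subseteq>) U"

lemma eqU_iff: "(n, m) \<in> eqU (RO P) (\<subseteq>) U \<longleftrightarrow> n \<in> parts P \<and> m \<in> parts P \<and> tv P (=) n m \<in> U"
  unfolding eqU_def by (auto simp: partitions_RO tv_eq_RO)

lemma eqU_equiv:
  assumes U: "ultra P U" shows "equiv (parts P) (eqU (RO P) (\<subseteq>) U)"
proof (rule equivI)
  show "eqU (RO P) (\<subseteq>) U \<subseteq> parts P \<times> parts P" by (auto simp: eqU_iff)
  show "refl_on (parts P) (eqU (RO P) (\<subseteq>) U)"
    by (auto simp: refl_on_def eqU_iff tv_refl ultra_P[OF U])
  show "sym (eqU (RO P) (\<subseteq>) U)"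
    unfolding sym_def eqU_iff using tv_eq_sym by metis
  show "trans (eqU (RO P) (\<subseteq>) U)"
    unfolding trans_def eqU_iff using ultra_tv_trans[OF U, of "(=)" _ _ "(=)" _ "(=)"] by blast
qed

lemma upow_RO: "upw P U = parts P // eqU (RO P) (\<subseteq>) U"
  unfolding upow_def partitions_RO ..

lemma upw_cases: "c \<in> upw P U \<Longrightarrow> \<exists>n\<in>parts P. c = cls P U n"
  unfolding upow_RO by (auto elim: quotientE)

lemma cls_in: "n \<in> parts P \<Longrightarrow> cls P U n \<in> upw P U"
  unfolding upow_RO by (rule quotientI)

lemma cls_eq: "ultra P U \<Longrightarrow> n \<in> parts P \<Longrightarrow> m \<in> parts P \<Longrightarrow> cls P U n = cls P U m \<longleftrightarrow> tv P (=) n m \<in> U"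
  by (simp add: eq_equiv_class_iff[OF eqU_equiv] eqU_iff)

text \<open>\<open>upow_less\<close> asks for some pair of representatives; transitivity through the
  equalities carries their inequality over to \<open>n\<close> and \<open>m\<close>.\<close>

lemma upl_cls:
  assumes U: "ultra P U" and n: "n \<in> parts P" and m: "m \<in> parts P"
  shows "upl P U (cls P U n) (cls P U m) \<longleftrightarrow> tv P (<) n m \<in> U"
proof
  assume "tv P (<) n m \<in> U"
  moreover have "n \<in> cls P U n" "m \<in> cls P U m" using equiv_class_self[OF eqU_equiv[OF U]] n m by blast+
  ultimately show "upl P U (cls P U n) (cls P U m)" unfolding upow_less_def
    by (metis n m tv_less_RO)
next
  assume "upl P U (cls P U n) (cls P U m)"
  then obtain n' m' where *: "n' \<in> parts P" "m' \<in> parts P" "tv P (=) n n' \<in> U" "tv P (=) m m' \<in> U"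
    "tv P (<) n' m' \<in> U"
    unfolding upow_less_def by (auto simp: eqU_iff tv_less_RO)
  then have "tv P (=) m' m \<in> U" using tv_eq_sym by metis
  moreover have "tv P (<) n m' \<in> U" using ultra_tv_trans[OF U *(3,5)] * n m by blast
  ultimately show "tv P (<) n m \<in> U" using ultra_tv_trans[OF U, of "(<)" n m' "(=)" m "(<)"] * n m by blast
qed

text \<open>Both inequalities would put the truth value of \<open>n < n\<close> into
  \<open>U\<close>, but no condition forces it, because some extension decides
  \<open>n\<close>.\<close>

lemma upl_asym:
  assumes U: "ultra P U" and "c \<in> upw P U" "d \<in> upw P U" "upl P U c d" "upl P U d c"
  shows False
proof -
  obtain n m where *: "n \<in> parts P" "c = cls P U n" "m \<in> parts P" "d = cls P U m" using assms upw_cases by metis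
  then have "tv P (<) n m \<in> U" "tv P (<) m n \<in> U" using assms upl_cls by blast+
  then have "tv P (<) n n \<in> U" using ultra_tv_trans[OF U, of "(<)" n m "(<)" n "(<)"] * by auto
  from ultra_Int[OF U this] have "tv P (<) n n \<inter> tv P (=) n n \<in> U" using * ultra_P[OF U] tv_refl[of n P] by simp
  moreover have "tv P (<) n n \<inter> tv P (=) n n = {}"
    unfolding tv_def using parts_ext[OF *(1)] by blast
  ultimately show False using ultra_empty[OF U] by simp
qed

lemma omega_iff:
  assumes U: "ultra P U" and n: "n \<in> parts P"
  shows "cls P U n \<in> upow_omega (RO P) (\<subseteq>) U \<longleftrightarrow> \<not> nonstd U n"
  unfolding upow_omega_def const_part_RO nonstd_def
  using cls_eq[OF U n const_name_parts] by (auto simp: tv_const_name[OF n])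

lemma omega_sub: "upow_omega (RO P) (\<subseteq>) U \<subseteq> upw P U"
  unfolding upow_omega_def const_part_RO using cls_in[OF const_name_parts] by blast

section \<open>Finite partial functions\<close>

text \<open>A point \<open>x\<close> of \<open>X\<close> stands for the assertion that the generic function has value
  \<open>(sv x, nv x)\<close> at the argument \<open>(col x, lev x)\<close>; conditions are finite consistent sets of points.\<close>

locale conditions =
  fixes X :: "'a set" and col :: "'a \<Rightarrow> 'm" and lev :: "'a \<Rightarrow> 'l" and sv :: "'a \<Rightarrow> 'k set"
    and nv :: "'a \<Rightarrow> nat" and M :: "'m set" and L :: "'l set" and K :: "'k set"
  assumes point: "i \<in> M \<Longrightarrow> \<alpha> \<in> L \<Longrightarrow> s \<in> Fpow K \<Longrightarrow> \<exists>x\<in>X. col x = i \<and> lev x = \<alpha> \<and> sv x = s \<and> nv x = k"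
    and col_M: "x \<in> X \<Longrightarrow> col x \<in> M"
    and lev_L: "x \<in> X \<Longrightarrow> lev x \<in> L"
    and sv_K: "x \<in> X \<Longrightarrow> sv x \<in> Fpow K"
    and point_eq: "x \<in> X \<Longrightarrow> y \<in> X \<Longrightarrow> col x = col y \<Longrightarrow> lev x = lev y \<Longrightarrow> sv x = sv y \<Longrightarrow> nv x = nv y \<Longrightarrow> x = y"
    and K_inf: "infinite K"
begin

definition slot :: "'a \<Rightarrow> 'm \<times> 'l" where
  "slot x = (col x, lev x)"

text \<open>Injectivity of \<open>slot\<close> makes a condition the graph of a finite partial
  function. Subsets of conditions are conditions, so \<open>p\<close> and \<open>q\<close> are
  compatible exactly when \<open>p \<union> q\<close> is a condition.\<close>

definition P :: "'a set set" where
  "P = {p. finite p \<and> p \<subseteq> X \<and> inj_on slot p}"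

lemma P_sub: "p \<in> P \<Longrightarrow> q \<subseteq> p \<Longrightarrow> q \<in> P"
  unfolding P_def using finite_subset inj_on_subset by blast

lemma P_slot: "p \<in> P \<Longrightarrow> x \<in> p \<Longrightarrow> y \<in> p \<Longrightarrow> slot x = slot y \<Longrightarrow> x = y"
  unfolding P_def inj_on_def by blast

lemma P_X: "p \<in> P \<Longrightarrow> x \<in> p \<Longrightarrow> x \<in> X"
  unfolding P_def by blast

lemma P_Un:
  assumes "p \<in> P" "q \<in> P" "\<And>x y. x \<in> p \<Longrightarrow> y \<in> q \<Longrightarrow> slot x = slot y \<Longrightarrow> x = y"
  shows "p \<union> q \<in> P"
proof -
  have "inj_on slot (p \<union> q)"
  proof (rule inj_onI)
    fix x y assume "x \<in> p \<union> q" "y \<in> p \<union> q" "slot x = slot y"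
    then show "x = y" using P_slot[OF assms(1)] P_slot[OF assms(2)] assms(3) by (metis UnE)
  qed
  then show ?thesis using assms(1,2) unfolding P_def by simp
qed

lemma P_empty: "{} \<in> P"
  unfolding P_def by simp

lemma weaker_Un1 [simp]: "p \<preceq> p \<union> q"
  unfolding weaker_def by simp

lemma weaker_Un2 [simp]: "q \<preceq> p \<union> q"
  unfolding weaker_def by simp

lemma weaker_insert [simp]: "p \<preceq> insert x p"
  unfolding weaker_def by blast

lemma weaker_mem: "p \<preceq> q \<Longrightarrow> x \<in> p \<Longrightarrow> x \<in> q"
  unfolding weaker_def by blast

lemma ext_point:
  assumes "p \<in> P" "x \<in> X" "\<And>y. y \<in> p \<Longrightarrow> slot y \<noteq> slot x"
  shows "p \<union> {x} \<in> P"
  using assms by (intro P_Un) (auto simp: P_def)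

lemma ext_slot:
  assumes "p \<in> P" "i \<in> M" "\<alpha> \<in> L"
  shows "\<exists>q\<in>P. p \<preceq> q \<and> (\<exists>x\<in>q. slot x = (i, \<alpha>))"
proof (cases "\<exists>x\<in>p. slot x = (i, \<alpha>)")
  case True then show ?thesis using assms(1) by blast
next
  case False
  obtain x where x: "x \<in> X" "slot x = (i, \<alpha>)"
    using point[OF assms(2,3), of "{}"] by (auto simp: slot_def Fpow_def)
  then have "p \<union> {x} \<in> P" using ext_point[OF assms(1)] False by metis
  then show ?thesis using x by (intro bexI[of _ "p \<union> {x}"]) auto
qed

subsection \<open>Restriction to a set of levels\<close>

definition restr :: "'l set \<Rightarrow> 'a set \<Rightarrow> 'a set" where
  "restr J p = {x\<in>p. lev x \<in> J}"

text \<open>The complete subalgebra of the sets supported on the levels in \<open>J\<close>: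
  restriction weakens a condition and \<open>A\<close> is up-closed, so membership in
  \<open>A\<close> depends only on the part of a condition at levels in \<open>J\<close>.\<close>

definition level_alg :: "'l set \<Rightarrow> 'a set set set" where
  "level_alg J = {A\<in>RO P. \<forall>p\<in>A. restr J p \<in> A}"

lemma restr_weaker [simp]: "restr J p \<preceq> p"
  unfolding restr_def weaker_def by blast

lemma restr_P: "p \<in> P \<Longrightarrow> restr J p \<in> P"
  using P_sub restr_weaker unfolding weaker_def by blast

text \<open>Both unions are conditions exactly when \<open>p\<close> and \<open>q\<close> agree on
  their common slots at levels in \<open>J\<close>. This symmetry moves a restriction from one
  condition to the other.\<close>

lemma restr_Un_P:
  assumes "p \<in> P" "q \<in> P" "restr J p \<union> q \<in> P" shows "restr J q \<union> p \<in> P"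
proof (rule P_Un)
  fix x y assume xy: "x \<in> restr J q" "y \<in> p" "slot x = slot y"
  then have "y \<in> restr J p" unfolding restr_def slot_def by auto
  then show "x = y" using P_slot[OF assms(3)] xy unfolding restr_def by blast
qed (use assms restr_P in auto)

lemma level_alg_RO: "A \<in> level_alg J \<Longrightarrow> A \<in> RO P"
  unfolding level_alg_def by simp

lemma level_alg_restr: "A \<in> level_alg J \<Longrightarrow> p \<in> A \<Longrightarrow> restr J p \<in> A"
  unfolding level_alg_def by simp

lemma level_alg_mono:
  assumes "I \<subseteq> J" "A \<in> level_alg I" shows "A \<in> level_alg J"
proof -
  have "restr J p \<in> A" if "p \<in> A" for p
  proof -
    have "restr I p \<preceq> restr J p" using assms(1) unfolding restr_def weaker_def by blast
    then show ?thesis using RO_up[OF level_alg_RO[OF assms(2)] level_alg_restr[OF assms(2) that]] that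
        RO_sub[OF level_alg_RO[OF assms(2)]] restr_P by blast
  qed
  then show ?thesis using level_alg_RO[OF assms(2)] unfolding level_alg_def by simp
qed

lemma level_alg_P: "P \<in> level_alg J"
  unfolding level_alg_def using RO_P restr_P by simp

lemma level_alg_Int: "A \<in> level_alg J \<Longrightarrow> B \<in> level_alg J \<Longrightarrow> A \<inter> B \<in> level_alg J"
  unfolding level_alg_def using RO_Int by auto

text \<open>For an extension \<open>q\<close> of \<open>restr J p\<close> in \<open>A\<close>, the
  condition \<open>restr J q\<close> would be in \<open>A\<close> too and compatible with
  \<open>p\<close>, and their union would be an extension of \<open>p\<close> in
  \<open>A\<close>.\<close>

lemma level_alg_perp:
  assumes "A \<in> level_alg J" shows "perp P A \<in> level_alg J"
proof -
  have "restr J p \<in> perp P A" if p: "p \<in> perp P A" for p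
  proof (rule perpI)
    have pP: "p \<in> P" using p perp_sub by blast
    then show "restr J p \<in> P" by (rule restr_P)
    fix q assume q: "q \<in> A" "restr J p \<preceq> q"
    then have qP: "q \<in> P" using RO_sub[OF level_alg_RO[OF assms]] by blast
    have "restr J p \<union> q = q" using q(2) unfolding weaker_def by blast
    then have "restr J q \<union> p \<in> P" using restr_Un_P[OF pP qP] qP by simp
    then have "restr J q \<union> p \<in> A" using RO_up[OF level_alg_RO[OF assms] level_alg_restr[OF assms q(1)]] by simp
    then show False using perpD[OF p] weaker_Un2 by blast
  qed
  then show ?thesis unfolding level_alg_def using perp_RO[OF level_alg_RO[OF assms]] by simp
qed

text \<open>\<open>restr_Un_P\<close> is used twice. For \<open>q\<close> above
  \<open>restr J p\<close>, the condition \<open>restr J q\<close> is compatible with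
  \<open>p\<close>, so some \<open>r\<close> in some \<open>A\<close> of \<open>S\<close> extends
  both; then \<open>restr J r\<close> is in \<open>A\<close> and is compatible with
  \<open>q\<close>.\<close>

lemma level_alg_reg_closure:
  assumes "S \<subseteq> level_alg J" shows "reg_closure P (\<Union>S) \<in> level_alg J"
proof -
  have S: "S \<subseteq> RO P" using assms level_alg_RO by blast
  have "restr J p \<in> reg_closure P (\<Union>S)" if p: "p \<in> reg_closure P (\<Union>S)" for p
  proof (rule reg_closureI)
    have pP: "p \<in> P" using p reg_closure_sub by blast
    then show "restr J p \<in> P" by (rule restr_P)
    fix q assume q: "q \<in> P" "restr J p \<preceq> q"
    have "restr J p \<union> q = q" using q(2) unfolding weaker_def by blast
    then have "restr J q \<union> p \<in> P" using restr_Un_P[OF pP q(1)] q(1) by simp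
    then obtain r where r: "r \<in> \<Union>S" "restr J q \<union> p \<preceq> r" using reg_closureD[OF p] by (metis weaker_Un2)
    then obtain A where A: "A \<in> S" "r \<in> A" by blast
    have rP: "r \<in> P" using r(1) Union_sub[OF S] by blast
    have "restr J q \<preceq> r" using r(2) weaker_trans weaker_Un1 by metis
    then have "restr J q \<union> r \<in> P" using rP unfolding weaker_def by (simp add: sup_absorb2)
    then have "restr J r \<union> q \<in> P" using restr_Un_P[OF q(1) rP] by simp
    moreover have "restr J r \<in> A" using level_alg_restr A assms by blast
    ultimately have "restr J r \<union> q \<in> A" using RO_up[of A P] A S by (meson subsetD weaker_Un1)
    then show "\<exists>r\<in>\<Union>S. q \<preceq> r" using A by (meson UnionI weaker_Un2)
  qed
  then show ?thesis unfolding level_alg_def using RO_reg_closure[OF S] by simp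
qed

lemma level_alg_tv:
  assumes "n \<in> parts P" "m \<in> parts P" "\<And>i. n i \<in> level_alg J" "\<And>i. m i \<in> level_alg J"
  shows "tv P R n m \<in> level_alg J"
  unfolding tv_eq_reg_closure[OF assms(1,2)] by (rule level_alg_reg_closure) (use assms level_alg_Int in auto)

subsection \<open>Generic objects\<close>

definition slot_val :: "'m \<Rightarrow> 'l \<Rightarrow> ('a \<Rightarrow> bool) \<Rightarrow> 'a set set" where
  "slot_val i \<alpha> Q = {p\<in>P. \<exists>x\<in>p. slot x = (i, \<alpha>) \<and> Q x}"

text \<open>Some value must violate \<open>Q\<close>: a condition that leaves the slot undecided is
  kept out of the regular closure by adding such a point \<open>y\<close>. A condition that decides
  the slot against \<open>Q\<close> has no extension in the set.\<close>

lemma slot_val_RO: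
  assumes "\<exists>y\<in>X. slot y = (i, \<alpha>) \<and> \<not> Q y" shows "slot_val i \<alpha> Q \<in> RO P"
proof (rule ROI)
  fix p assume p: "p \<in> P" "p \<notin> slot_val i \<alpha> Q"
  obtain y where y: "y \<in> X" "slot y = (i, \<alpha>)" "\<not> Q y" using assms by blast
  show "\<exists>q\<in>P. p \<preceq> q \<and> (\<forall>r\<in>slot_val i \<alpha> Q. \<not> q \<preceq> r)"
  proof (cases "\<exists>x\<in>p. slot x = (i, \<alpha>)")
    case True
    then obtain x where x: "x \<in> p" "slot x = (i, \<alpha>)" "\<not> Q x" using p unfolding slot_val_def by blast
    have "\<not> p \<preceq> r" if "r \<in> slot_val i \<alpha> Q" for r
      using that x P_slot[of r x] weaker_mem[of p r x] unfolding slot_val_def by force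
    then show ?thesis using p(1) by blast
  next
    case False
    have "p \<union> {y} \<in> P" using ext_point[OF p(1) y(1)] False y(2) by metis
    moreover have "\<not> p \<union> {y} \<preceq> r" if "r \<in> slot_val i \<alpha> Q" for r
      using that y P_slot[of r y] weaker_mem[of "p \<union> {y}" r y] unfolding slot_val_def by force
    ultimately show ?thesis by (intro bexI[of _ "p \<union> {y}"]) auto
  qed
next
  fix p q assume "p \<in> slot_val i \<alpha> Q" "q \<in> P" "p \<preceq> q"
  then show "q \<in> slot_val i \<alpha> Q" unfolding slot_val_def using weaker_mem[of p q] by (simp, metis)
qed (auto simp: slot_val_def)

lemma slot_val_level_alg:
  assumes "\<exists>y\<in>X. slot y = (i, \<alpha>) \<and> \<not> Q y" "\<alpha> \<in> J" shows "slot_val i \<alpha> Q \<in> level_alg J"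
proof -
  have "restr J p \<in> slot_val i \<alpha> Q" if "p \<in> slot_val i \<alpha> Q" for p
    using that restr_P[of p J] assms(2) unfolding slot_val_def restr_def slot_def by auto
  then show ?thesis unfolding level_alg_def using slot_val_RO[OF assms(1)] by simp
qed

definition num :: "'m \<Rightarrow> 'l \<Rightarrow> nat \<Rightarrow> 'a set set" where
  "num i \<alpha> k = slot_val i \<alpha> (\<lambda>x. nv x = k)"

definition set_val :: "'m \<Rightarrow> 'l \<Rightarrow> 'k set \<Rightarrow> 'a set set" where
  "set_val i \<alpha> s = slot_val i \<alpha> (\<lambda>x. sv x = s)"

lemma num_level_alg: "i \<in> M \<Longrightarrow> \<alpha> \<in> L \<Longrightarrow> \<alpha> \<in> J \<Longrightarrow> num i \<alpha> k \<in> level_alg J"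
  unfolding num_def using point[of i \<alpha> "{}" "Suc k"]
  by (intro slot_val_level_alg) (auto simp: slot_def Fpow_def)

lemma set_val_level_alg: "i \<in> M \<Longrightarrow> \<alpha> \<in> L \<Longrightarrow> \<alpha> \<in> J \<Longrightarrow> set_val i \<alpha> s \<in> level_alg J"
proof -
  assume *: "i \<in> M" "\<alpha> \<in> L" "\<alpha> \<in> J"
  \<comment> \<open>One of the sets \<open>{}\<close> and \<open>{a}\<close> differs from
    \<open>s\<close>, which supplies the violating point that \<open>slot_val_level_alg\<close> asks
    for.\<close>
  obtain a where "a \<in> K" using K_inf by fastforce
  then have "{} \<in> Fpow K" "{a} \<in> Fpow K" by (auto simp: Fpow_def)
  then obtain s' where "s' \<in> Fpow K" "s' \<noteq> s" by blast
  then show ?thesis unfolding set_val_def using point[of i \<alpha> s' 0] *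
    by (intro slot_val_level_alg) (auto simp: slot_def)
qed

lemma slot_val_mem:
  assumes "x \<in> p" "p \<in> P" "slot x = (i, \<alpha>)" shows "p \<in> slot_val i \<alpha> Q \<longleftrightarrow> Q x"
proof
  assume "p \<in> slot_val i \<alpha> Q"
  then obtain y where y: "y \<in> p" "slot y = (i, \<alpha>)" "Q y" unfolding slot_val_def by blast
  then have "y = x" using P_slot[OF assms(2) y(1) assms(1)] assms(3) by simp
  then show "Q x" using y by simp
qed (use assms in \<open>auto simp: slot_val_def\<close>)

lemma num_mem: "x \<in> p \<Longrightarrow> p \<in> P \<Longrightarrow> slot x = (i, \<alpha>) \<Longrightarrow> p \<in> num i \<alpha> k \<longleftrightarrow> nv x = k"
  unfolding num_def by (rule slot_val_mem)

lemma set_val_mem: "x \<in> p \<Longrightarrow> p \<in> P \<Longrightarrow> slot x = (i, \<alpha>) \<Longrightarrow> p \<in> set_val i \<alpha> s \<longleftrightarrow> sv x = s"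
  unfolding set_val_def by (rule slot_val_mem)

lemma num_parts:
  assumes "i \<in> M" "\<alpha> \<in> L" shows "num i \<alpha> \<in> parts P"
proof -
  have "num i \<alpha> j \<inter> num i \<alpha> k = {}" if "j \<noteq> k" for j k
  proof -
    have "j = k" if p: "p \<in> num i \<alpha> j" "p \<in> num i \<alpha> k" for p
    proof -
      obtain x where "x \<in> p" "slot x = (i, \<alpha>)" "p \<in> P" using p(1) unfolding num_def slot_val_def by blast
      then show ?thesis using p num_mem[of x p i \<alpha>] by simp
    qed
    then show ?thesis using that by blast
  qed
  moreover have "\<exists>q\<in>P. p \<preceq> q \<and> (\<exists>k. q \<in> num i \<alpha> k)" if "p \<in> P" for p
    using ext_slot[OF that assms] num_mem by metis
  moreover have "num i \<alpha> k \<in> RO P" for k using level_alg_RO num_level_alg[OF assms assms(2)] by blast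
  ultimately show ?thesis unfolding parts_def by simp
qed

text \<open>If the generic set value at \<open>(i, \<alpha>)\<close> is \<open>s\<close>, then \<open>A s\<close> is made to decide which \<open>t\<close> are accepted, namely
  the subsets of \<open>s\<close>; hence multiplicativity. One column serves all distributions at once.\<close>

definition mult_ref :: "('k set \<Rightarrow> 'a set set) \<Rightarrow> 'm \<Rightarrow> 'l \<Rightarrow> 'k set \<Rightarrow> 'a set set" where
  "mult_ref A i \<alpha> t = reg_closure P (\<Union>{A s \<inter> set_val i \<alpha> s | s. s \<in> Fpow K \<and> t \<subseteq> s})"

lemma mult_ref_level_alg:
  assumes "i \<in> M" "\<alpha> \<in> L" "\<alpha> \<in> J" "\<And>s. s \<in> Fpow K \<Longrightarrow> A s \<in> level_alg J"
  shows "mult_ref A i \<alpha> t \<in> level_alg J"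
  unfolding mult_ref_def by (rule level_alg_reg_closure) (use assms level_alg_Int set_val_level_alg in auto)

lemma mult_ref_mono: "t \<subseteq> t' \<Longrightarrow> mult_ref A i \<alpha> t' \<subseteq> mult_ref A i \<alpha> t"
  unfolding mult_ref_def by (rule reg_closure_mono) blast

lemma mult_ref_le:
  assumes A: "distribution (RO P) (\<subseteq>) K A" and t: "t \<in> Fpow K"
  shows "mult_ref A i \<alpha> t \<subseteq> A t"
  unfolding mult_ref_def
proof (rule reg_closure_least)
  show "A t \<in> RO P" using A t unfolding distribution_def Fpow_def by simp
  have "A s \<subseteq> A t" if "s \<in> Fpow K" "t \<subseteq> s" for s
    using A that unfolding distribution_def Fpow_def by simp
  then show "\<Union>{A s \<inter> set_val i \<alpha> s | s. s \<in> Fpow K \<and> t \<subseteq> s} \<subseteq> A t" by blast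
qed

text \<open>Extend to a condition \<open>q'\<close> that decides the set value at the slot.
  Membership for each \<open>\<beta>\<close> in \<open>t\<close> then forces \<open>\<beta>\<close>
  into that one value \<open>sv x\<close>, so \<open>t \<subseteq> sv x\<close>, and the witness for
  a single \<open>\<beta>\<close> serves all of \<open>t\<close>. For empty \<open>t\<close> the
  right side is the unit, which \<open>mult_ref\<close> need not reach.\<close>

lemma mult_ref_multiplicative:
  assumes A: "\<And>s. s \<in> Fpow K \<Longrightarrow> A s \<in> RO P" and i: "i \<in> M" "\<alpha> \<in> L" and t: "t \<in> Fpow K" "t \<noteq> {}"
  shows "mult_ref A i \<alpha> t = P \<inter> (\<Inter>\<beta>\<in>t. mult_ref A i \<alpha> {\<beta>})"
proof
  have "mult_ref A i \<alpha> t \<subseteq> mult_ref A i \<alpha> {\<beta>}" if "\<beta> \<in> t" for \<beta> using that by (intro mult_ref_mono) simp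
  moreover have "mult_ref A i \<alpha> t \<subseteq> P" unfolding mult_ref_def by (rule reg_closure_sub)
  ultimately show "mult_ref A i \<alpha> t \<subseteq> P \<inter> (\<Inter>\<beta>\<in>t. mult_ref A i \<alpha> {\<beta>})" by blast
  show "P \<inter> (\<Inter>\<beta>\<in>t. mult_ref A i \<alpha> {\<beta>}) \<subseteq> mult_ref A i \<alpha> t"
  proof
    fix p assume p: "p \<in> P \<inter> (\<Inter>\<beta>\<in>t. mult_ref A i \<alpha> {\<beta>})"
    show "p \<in> mult_ref A i \<alpha> t"
      unfolding mult_ref_def
    proof (rule reg_closureI)
      show "p \<in> P" using p by simp
      fix q assume q: "q \<in> P" "p \<preceq> q"
      obtain q' x where q': "q' \<in> P" "q \<preceq> q'" "x \<in> q'" "slot x = (i, \<alpha>)" using ext_slot[OF q(1) i] by blast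
      have "p \<preceq> q'" using q q' weaker_trans by blast
      have *: "\<exists>r s. r \<in> A s \<and> s \<in> Fpow K \<and> r \<in> set_val i \<alpha> s \<and> \<beta> \<in> s \<and> q' \<preceq> r" if "\<beta> \<in> t" for \<beta>
      proof -
        have "p \<in> reg_closure P (\<Union>{A s \<inter> set_val i \<alpha> s | s. s \<in> Fpow K \<and> {\<beta>} \<subseteq> s})" using p that unfolding mult_ref_def by blast
        from reg_closureD[OF this q'(1) \<open>p \<preceq> q'\<close>] show ?thesis by blast
      qed
      have sx: "s = sv x" if "r \<in> set_val i \<alpha> s" "q' \<preceq> r" for r s
        using that set_val_mem[of x r i \<alpha> s] weaker_mem[OF that(2) q'(3)] q'(4) unfolding set_val_def slot_val_def by blast
      have "t \<subseteq> sv x" using * sx by blast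
      moreover obtain \<beta> where "\<beta> \<in> t" using t by blast
      moreover from *[OF this] obtain r s where "r \<in> A s" "s \<in> Fpow K" "r \<in> set_val i \<alpha> s" "q' \<preceq> r" by blast
      moreover have "q \<preceq> r" using q' calculation weaker_trans by blast
      ultimately show "\<exists>r\<in>\<Union>{A s \<inter> set_val i \<alpha> s | s. s \<in> Fpow K \<and> t \<subseteq> s}. q \<preceq> r"
        using sx by blast
    qed
  qed
qed

subsection \<open>One extension step\<close>

text \<open>A finite approximation to the requirements on level \<open>\<alpha>\<close>: set values
  containing a given finite set, numbers beyond a given bound, distinct numbers in distinct columns.
  Columns outside \<open>F\<close> are allowed, so that larger parameters give stronger
  requirements.\<close>

definition generic_cond :: "'l \<Rightarrow> 'm set \<Rightarrow> 'k set \<Rightarrow> nat \<Rightarrow> 'a set \<Rightarrow> bool" where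
  "generic_cond \<alpha> F t N q \<longleftrightarrow> q \<in> P \<and> F \<subseteq> col ` q \<and> inj_on nv q \<and> (\<forall>x\<in>q. lev x = \<alpha> \<and> t \<subseteq> sv x \<and> N \<le> nv x)"

text \<open>Taking the sets that all sufficiently generic conditions force over \<open>V\<close>, instead of the filter
  generated by a list of requirements, makes closure under intersection immediate.\<close>

definition step_filter :: "'a set set set \<Rightarrow> 'l \<Rightarrow> 'a set set set" where
  "step_filter V \<alpha> = {Y\<in>RO P. \<exists>F t N. finite F \<and> F \<subseteq> M \<and> t \<in> Fpow K \<and>
     (\<forall>q. generic_cond \<alpha> F t N q \<longrightarrow> (\<exists>a\<in>V. \<forall>p\<in>a. q \<preceq> p \<longrightarrow> p \<in> Y))}"

lemma step_filterI:
  assumes "Y \<in> RO P" "finite F" "F \<subseteq> M" "t \<in> Fpow K"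
    and "\<And>q. generic_cond \<alpha> F t N q \<Longrightarrow> \<exists>a\<in>V. \<forall>p\<in>a. q \<preceq> p \<longrightarrow> p \<in> Y"
  shows "Y \<in> step_filter V \<alpha>"
  using assms unfolding step_filter_def by (intro CollectI conjI exI[of _ F] exI[of _ t] exI[of _ N]) simp_all

lemma generic_cond_exists:
  assumes "finite F" "F \<subseteq> M" "t \<in> Fpow K" "\<alpha> \<in> L"
  shows "\<exists>q. generic_cond \<alpha> F t N q"
proof -
  obtain f :: "'m \<Rightarrow> nat" where f: "inj_on f F" using finite_imp_inj_to_nat_seg[OF assms(1)] by blast
  have "\<forall>i\<in>F. \<exists>x\<in>X. col x = i \<and> lev x = \<alpha> \<and> sv x = t \<and> nv x = N + f i"
    using point[OF _ assms(4,3)] assms(2) by blast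
  then obtain g where g: "\<And>i. i \<in> F \<Longrightarrow> g i \<in> X \<and> col (g i) = i \<and> lev (g i) = \<alpha> \<and> sv (g i) = t \<and> nv (g i) = N + f i"
    by metis
  have "generic_cond \<alpha> F t N (g ` F)"
    unfolding generic_cond_def
  proof (intro conjI ballI)
    have "inj_on slot (g ` F)" using g by (auto simp: inj_on_def slot_def)
    then show "g ` F \<in> P" unfolding P_def using g assms(1) by auto
    show "F \<subseteq> col ` g ` F" using g by force
    show "inj_on nv (g ` F)" using g f by (auto simp: inj_on_def)
  qed (use g in auto)
  then show ?thesis by blast
qed

lemma generic_cond_mono: "generic_cond \<alpha> F t N q \<Longrightarrow> F' \<subseteq> F \<Longrightarrow> t' \<subseteq> t \<Longrightarrow> N' \<le> N \<Longrightarrow> generic_cond \<alpha> F' t' N' q"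
  unfolding generic_cond_def by force

text \<open>Properness rests on the independence of the levels: a condition of \<open>a\<close> can
  be restricted to the levels in \<open>J\<close> without leaving \<open>a\<close>, and then shares
  no slot with a generic condition, which lives on level \<open>\<alpha>\<close>. For intersections
  the finite parameters are united and the larger bound is taken.\<close>

lemma step_filter_pfilter:
  assumes V: "V \<subseteq> level_alg J" "P \<in> V" "{} \<notin> V" "\<And>a b. a \<in> V \<Longrightarrow> b \<in> V \<Longrightarrow> a \<inter> b \<in> V"
    and \<alpha>: "\<alpha> \<in> L" "\<alpha> \<notin> J"
  shows "pfilter P (step_filter V \<alpha>)" and "V \<subseteq> step_filter V \<alpha>"
proof -
  show sub: "V \<subseteq> step_filter V \<alpha>"
  proof
    fix a assume "a \<in> V"
    then show "a \<in> step_filter V \<alpha>" using V(1) level_alg_RO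
      by (intro step_filterI[of a "{}" "{}"]) (auto simp: Fpow_def)
  qed
  show "pfilter P (step_filter V \<alpha>)"
  proof (rule pfilterI)
    show "P \<in> step_filter V \<alpha>" using sub V(2) by blast
    show "{} \<notin> step_filter V \<alpha>"
    proof
      assume "{} \<in> step_filter V \<alpha>"
      then obtain F t N where *: "finite F" "F \<subseteq> M" "t \<in> Fpow K"
        "\<And>q. generic_cond \<alpha> F t N q \<Longrightarrow> \<exists>a\<in>V. \<forall>p\<in>a. \<not> q \<preceq> p" unfolding step_filter_def by auto
      obtain q where q: "generic_cond \<alpha> F t N q" using generic_cond_exists[OF *(1-3) \<alpha>(1)] by blast
      obtain a where a: "a \<in> V" "\<And>p. p \<in> a \<Longrightarrow> \<not> q \<preceq> p" using *(4)[OF q] by blast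
      obtain p where p: "p \<in> a" using a(1) V(3) by (cases "a = {}") auto
      have aD: "a \<in> level_alg J" using a V(1) by blast
      then have rp: "restr J p \<in> a" using p level_alg_restr by blast
      have "restr J p \<in> P" using RO_sub[OF level_alg_RO[OF aD] rp] .
      then have "restr J p \<union> q \<in> P"
        using q \<alpha>(2) by (intro P_Un) (auto simp: generic_cond_def restr_def slot_def)
      then have "restr J p \<union> q \<in> a" using RO_up[OF level_alg_RO[OF aD] rp] by simp
      then show False using a(2) weaker_Un2 by blast
    qed
    fix a assume a: "a \<in> step_filter V \<alpha>"
    show "a \<in> RO P" using a unfolding step_filter_def by simp
    obtain F t N where *: "finite F" "F \<subseteq> M" "t \<in> Fpow K"
      "\<And>q. generic_cond \<alpha> F t N q \<Longrightarrow> \<exists>c\<in>V. \<forall>p\<in>c. q \<preceq> p \<longrightarrow> p \<in> a" using a unfolding step_filter_def by auto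
    { fix b assume b: "b \<in> step_filter V \<alpha>"
      obtain F' t' N' where **: "finite F'" "F' \<subseteq> M" "t' \<in> Fpow K"
        "\<And>q. generic_cond \<alpha> F' t' N' q \<Longrightarrow> \<exists>c\<in>V. \<forall>p\<in>c. q \<preceq> p \<longrightarrow> p \<in> b" using b unfolding step_filter_def by auto
      show "a \<inter> b \<in> step_filter V \<alpha>"
      proof (rule step_filterI[of _ "F \<union> F'" "t \<union> t'"])
        show "a \<inter> b \<in> RO P" using a b unfolding step_filter_def by (intro RO_Int) simp_all
        show "t \<union> t' \<in> Fpow K" using * ** unfolding Fpow_def by simp
        fix q assume q: "generic_cond \<alpha> (F \<union> F') (t \<union> t') (max N N') q"
        obtain c where c: "c \<in> V" "\<forall>p\<in>c. q \<preceq> p \<longrightarrow> p \<in> a" using *(4)[of q] generic_cond_mono[OF q, of F t N] by auto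
        obtain d where d: "d \<in> V" "\<forall>p\<in>d. q \<preceq> p \<longrightarrow> p \<in> b" using **(4)[of q] generic_cond_mono[OF q, of F' t' N'] by auto
        show "\<exists>c\<in>V. \<forall>p\<in>c. q \<preceq> p \<longrightarrow> p \<in> a \<inter> b"
          using c d V(4)[of c d] by (intro bexI[of _ "c \<inter> d"]) auto
      qed (use * ** in auto) }
    fix b assume b: "b \<in> RO P" "a \<subseteq> b"
    show "b \<in> step_filter V \<alpha>"
    proof (rule step_filterI[OF b(1) *(1-3)])
      fix q assume "generic_cond \<alpha> F t N q"
      then show "\<exists>c\<in>V. \<forall>p\<in>c. q \<preceq> p \<longrightarrow> p \<in> b" using *(4) b(2) by (meson subsetD)
    qed
  qed
qed

end

section \<open>Cardinalities\<close>

lemma card_of_Times_le: "infinite C \<Longrightarrow> |A| \<le>o |C| \<Longrightarrow> |B| \<le>o |C| \<Longrightarrow> |A \<times> B| \<le>o |C|"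
  by (rule card_of_Times_ordLeq_infinite_Field) (simp_all add: Field_card_of card_of_card_order_on)

lemma card_of_Un_le: "infinite C \<Longrightarrow> |A| \<le>o |C| \<Longrightarrow> |B| \<le>o |C| \<Longrightarrow> |A \<union> B| \<le>o |C|"
  by (rule card_of_Un_ordLeq_infinite_Field) (simp_all add: Field_card_of card_of_card_order_on)

lemma card_of_finite_le: "infinite C \<Longrightarrow> finite A \<Longrightarrow> |A| \<le>o |C|"
  using ordLeq_total[OF card_of_Well_order card_of_Well_order] card_of_ordLeq_finite by blast

lemma card_of_image_le: "|A| \<le>o |C| \<Longrightarrow> |f ` A| \<le>o |C|"
  using card_of_image ordLeq_transitive by blast

lemma card_of_subset_le: "A \<subseteq> B \<Longrightarrow> |B| \<le>o |C| \<Longrightarrow> |A| \<le>o |C|"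
  using card_of_mono1 ordLeq_transitive by blast

lemma card_of_insert_le: "infinite C \<Longrightarrow> |A| \<le>o |C| \<Longrightarrow> |insert a A| \<le>o |C|"
  using card_of_Un_le[of C "{a}" A] card_of_finite_le[of C "{a}"] by simp

lemma nat_le_infinite: "infinite C \<Longrightarrow> |A :: nat set| \<le>o |C|"
  using card_of_subset_le[of A UNIV C] infinite_iff_card_of_nat by blast

lemma card_of_UNION_nat_le:
  assumes "infinite C" "\<And>n::nat. |A n| \<le>o |C|" shows "|\<Union>n. A n| \<le>o |C|"
  using assms by (intro card_of_UNION_ordLeq_infinite) (auto simp: nat_le_infinite)

lemma card_of_Fpow_le:
  assumes "infinite A" shows "|Fpow A| \<le>o |A|"
proof -
  let ?F = "\<lambda>n. {s. s \<subseteq> A \<and> finite s \<and> card s = n}"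
  have "|?F n| \<le>o |A|" for n
  proof (induction n)
    case 0
    have "?F 0 \<subseteq> {{}}" by auto
    then have "finite (?F 0)" by (rule finite_subset) simp
    then show ?case by (rule card_of_finite_le[OF assms])
  next
    case (Suc n)
    have "?F (Suc n) \<subseteq> (\<lambda>(a, s). insert a s) ` (A \<times> ?F n)"
    proof
      fix s assume s: "s \<in> ?F (Suc n)"
      then obtain a where "a \<in> s" by (metis (mono_tags) card_Suc_eq insertI1 mem_Collect_eq)
      then show "s \<in> (\<lambda>(a, s). insert a s) ` (A \<times> ?F n)" using s
        by (intro image_eqI[of _ _ "(a, s - {a})"]) auto
    qed
    then show ?case
      by (rule card_of_subset_le[OF _ card_of_image_le[OF card_of_Times_le[OF assms ordLeq_refl[OF card_of_Card_order] Suc]]])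
  qed
  then have "|\<Union>n. ?F n| \<le>o |A|" by (rule card_of_UNION_nat_le[OF assms])
  moreover have "Fpow A \<subseteq> (\<Union>n. ?F n)" unfolding Fpow_def by blast
  ultimately show ?thesis by (rule card_of_subset_le[rotated])
qed

lemma card_of_Func_le:
  assumes "|M| ^c |K| =o |M|" "|A| \<le>o |K|" "K \<noteq> {}" "A \<noteq> {}" "|C| \<le>o |M|"
  shows "|Func A C| \<le>o |M|"
proof -
  have "|C| ^c |A| \<le>o |M| ^c |K|"
    using assms by (intro cexp_mono') (auto simp: Field_card_of)
  then show ?thesis unfolding cexp_def Field_card_of using assms(1) ordLeq_ordIso_trans
    unfolding cexp_def Field_card_of by blast
qed

text \<open>A nonempty \<open>W\<close> of size at most \<open>|K|\<close> is the range of a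
  function from \<open>K\<close> into \<open>Q\<close>, and there are at most \<open>|M|\<close> of
  these; the empty set is added separately.\<close>

lemma card_of_small_subsets_le:
  assumes "infinite M" "K \<noteq> {}" "|M| ^c |K| =o |M|" "|Q| \<le>o |M|"
  shows "|{W. W \<subseteq> Q \<and> |W| \<le>o |K| }| \<le>o |M|"
proof -
  have "{W. W \<subseteq> Q \<and> |W| \<le>o |K| } \<subseteq> insert {} ((\<lambda>f. f ` K) ` Func K Q)"
  proof
    fix W assume "W \<in> {W. W \<subseteq> Q \<and> |W| \<le>o |K| }"
    then have W: "W \<subseteq> Q" "|W| \<le>o |K|" by simp_all
    show "W \<in> insert {} ((\<lambda>f. f ` K) ` Func K Q)"
    proof (cases "W = {}")
      case False
      then obtain g where g: "g ` K = W" using W(2) card_of_ordLeq2[OF False] by metis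
      let ?g = "\<lambda>x. if x \<in> K then g x else undefined"
      have "?g \<in> Func K Q" using g W(1) unfolding Func_def by auto
      moreover have "?g ` K = W" using g by auto
      ultimately show ?thesis by blast
    qed simp
  qed
  moreover have "|insert {} ((\<lambda>f. f ` K) ` Func K Q)| \<le>o |M|"
    using card_of_insert_le[OF assms(1) card_of_image_le[OF card_of_Func_le[OF assms(3) ordLeq_refl[OF card_of_Card_order] assms(2,2,4)]]] .
  ultimately show ?thesis by (rule card_of_subset_le)
qed

text \<open>By regularity a smaller set is not cofinal, so some \<open>a\<close> has no member of
  \<open>S\<close> strictly after it. An infinite cardinal has no last element, and any
  \<open>\<alpha>\<close> beyond \<open>a\<close> is a strict bound.\<close>

lemma regular_bound:
  assumes "regularCard |L|" "infinite L" "S \<subseteq> L" "|S| <o |L|"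
  shows "\<exists>\<alpha>\<in>L. S \<subseteq> underS (card_of L) \<alpha>"
proof -
  have "\<not> cofinal S |L|" using assms unfolding regularCard_def Field_card_of
    using not_ordLess_ordIso by blast
  then obtain a where a: "a \<in> L" "\<And>b. b \<in> S \<Longrightarrow> a = b \<or> (a, b) \<notin> |L|"
    unfolding cofinal_def Field_card_of by blast
  obtain \<alpha> where \<alpha>: "\<alpha> \<in> L" "a \<noteq> \<alpha>" "(a, \<alpha>) \<in> |L|"
    using infinite_Card_order_limit[of "|L|" a] a(1) assms(2) by (auto simp: Field_card_of card_of_card_order_on)
  have wo: "wo_rel |L|" by (simp add: wo_rel_def card_of_Well_order)
  have "b \<in> underS (card_of L) \<alpha>" if "b \<in> S" for b
  proof -
    have "b \<in> Field |L|" "a \<in> Field |L|" using assms(3) that a(1) by (auto simp: Field_card_of)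
    then have "(b, a) \<in> |L|"
      using a(2)[OF that] wo_rel.TOTALS[OF wo] wo_rel.REFL[OF wo] unfolding refl_on_def by blast
    then have "(b, \<alpha>) \<in> |L|" "b \<noteq> \<alpha>"
      using \<alpha> wo_rel.TRANS[OF wo] wo_rel.ANTISYM[OF wo] unfolding trans_def antisym_def by blast+
    then show ?thesis unfolding underS_def by simp
  qed
  then show ?thesis using \<alpha>(1) by blast
qed

section \<open>Chain condition, size of the algebra and supports of its elements\<close>

context conditions
begin

lemma slot_card: "|{x\<in>X. slot x = c}| \<le>o |K|"
proof -
  have "inj_on (\<lambda>x. (sv x, nv x)) {x\<in>X. slot x = c}"
    by (rule inj_onI) (auto simp: slot_def intro: point_eq)
  moreover have "(\<lambda>x. (sv x, nv x)) ` {x\<in>X. slot x = c} \<subseteq> Fpow K \<times> UNIV" using sv_K by auto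
  ultimately have "|{x\<in>X. slot x = c}| \<le>o |Fpow K \<times> (UNIV::nat set)|" using card_of_ordLeq by blast
  moreover have "|Fpow K \<times> (UNIV::nat set)| \<le>o |K|"
    using card_of_Times_le[OF K_inf] card_of_Fpow_le[OF K_inf] nat_le_infinite[OF K_inf] by blast
  ultimately show ?thesis using ordLeq_transitive by blast
qed

definition antichain :: "'a set set \<Rightarrow> bool" where
  "antichain W \<longleftrightarrow> W \<subseteq> P \<and> (\<forall>p\<in>W. \<forall>q\<in>W. p \<noteq> q \<longrightarrow> p \<union> q \<notin> P)"

text \<open>Induction on the common size. Any \<open>p\<close> in \<open>W\<close> other than a
  fixed \<open>p0\<close> is incompatible with it and so contains a point at one of the finitely
  many slots of \<open>p0\<close>. There are at most \<open>|K|\<close> such points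
  \<open>x\<close>, and the conditions of \<open>W\<close> through \<open>x\<close>, with
  \<open>x\<close> removed, form an antichain of smaller size.\<close>

lemma antichain_card_fixed: "antichain W \<Longrightarrow> \<forall>p\<in>W. card p = n \<Longrightarrow> |W| \<le>o |K|"
proof (induction n arbitrary: W)
  case 0
  have "p = {}" if "p \<in> W" for p
  proof -
    have "finite p" using 0(1) that unfolding antichain_def P_def by blast
    moreover have "card p = 0" using 0(2) that by blast
    ultimately show ?thesis by simp
  qed
  then have "W \<subseteq> {{}}" by blast
  then have "finite W" by (rule finite_subset) simp
  then show ?case by (rule card_of_finite_le[OF K_inf])
next
  case (Suc n)
  show ?case
  proof (cases "W = {}")
    case True then show ?thesis using card_of_finite_le[OF K_inf, of W] by simp
  next
    case False
    then obtain p0 where p0: "p0 \<in> W" by blast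
    have WP: "W \<subseteq> P" using Suc.prems(1) unfolding antichain_def by blast
    define S where "S = (\<Union>c\<in>slot ` p0. {x\<in>X. slot x = c})"
    define Z where "Z x = {p\<in>W. x \<in> p}" for x
    have "finite p0" using p0 WP unfolding P_def by blast
    then have S: "|S| \<le>o |K|" unfolding S_def
      using slot_card by (intro card_of_UNION_ordLeq_infinite[OF K_inf]) (auto intro: card_of_finite_le[OF K_inf])
    have Z: "|Z x| \<le>o |K|" for x
    proof -
      let ?W = "(\<lambda>p. p - {x}) ` Z x"
      have "antichain ?W"
        unfolding antichain_def
      proof (intro conjI ballI impI)
        show "?W \<subseteq> P" using WP P_sub[OF _ Diff_subset] unfolding Z_def by blast
        fix a b assume "a \<in> ?W" "b \<in> ?W" "a \<noteq> b"
        then obtain p q where pq: "p \<in> Z x" "q \<in> Z x" "a = p - {x}" "b = q - {x}" by blast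
        then have P: "p \<in> P" "q \<in> P" "x \<in> p" "x \<in> q" using WP unfolding Z_def by auto
        have "p \<noteq> q" using pq \<open>a \<noteq> b\<close> by blast
        then have nP: "p \<union> q \<notin> P" using Suc.prems(1) pq unfolding antichain_def Z_def by blast
        show "a \<union> b \<notin> P"
        proof
          assume ab: "a \<union> b \<in> P"
          have "p \<union> q \<in> P"
          proof (rule P_Un)
            fix y z assume yz: "y \<in> p" "z \<in> q" "slot y = slot z"
            show "y = z"
            proof (cases "y = x \<or> z = x")
              case True
              then show ?thesis using P_slot[OF P(1) yz(1) P(3)] P_slot[OF P(2) yz(2) P(4)] yz(3) by metis
            next
              case False
              then show ?thesis using P_slot[OF ab] yz pq by blast
            qed
          qed (use P in auto)
          then show False using nP by blast
        qed
      qed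
      moreover have "\<forall>p\<in>?W. card p = n" using Suc.prems(2) unfolding Z_def by auto
      ultimately have "|?W| \<le>o |K|" by (rule Suc.IH)
      then have "|insert x ` ?W| \<le>o |K|" by (rule card_of_image_le)
      moreover have "Z x \<subseteq> insert x ` ?W"
      proof
        fix p assume "p \<in> Z x"
        then have "p = insert x (p - {x})" unfolding Z_def by blast
        then show "p \<in> insert x ` ?W" using \<open>p \<in> Z x\<close> by blast
      qed
      ultimately show ?thesis by (rule card_of_subset_le[rotated])
    qed
    have "p \<in> insert p0 (\<Union>x\<in>S. Z x)" if p: "p \<in> W" for p
    proof (cases "p = p0")
      case False
      then have "p \<union> p0 \<notin> P" using Suc.prems(1) p p0 unfolding antichain_def by blast
      then obtain x y where "x \<in> p" "y \<in> p0" "slot x = slot y"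
        using P_Un[of p p0] p p0 WP by blast
      moreover have "x \<in> X" using P_X p WP \<open>x \<in> p\<close> by blast
      ultimately show ?thesis using p unfolding S_def Z_def by auto
    qed simp
    then have "W \<subseteq> insert p0 (\<Union>x\<in>S. Z x)" by blast
    moreover have "|insert p0 (\<Union>x\<in>S. Z x)| \<le>o |K|"
      using S Z by (intro card_of_insert_le[OF K_inf] card_of_UNION_ordLeq_infinite[OF K_inf]) simp_all
    ultimately show ?thesis by (rule card_of_subset_le)
  qed
qed

lemma antichain_card:
  assumes "antichain W" shows "|W| \<le>o |K|"
proof -
  have "|{p\<in>W. card p = n}| \<le>o |K|" for n
    using assms by (intro antichain_card_fixed[of _ n]) (auto simp: antichain_def)
  then have "|\<Union>n. {p\<in>W. card p = n}| \<le>o |K|" by (rule card_of_UNION_nat_le[OF K_inf])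
  then show ?thesis by (rule card_of_subset_le[rotated]) blast
qed

text \<open>Choosing a condition from each member gives an antichain, since a common extension of
  \<open>f a\<close> and \<open>f b\<close> would lie in both \<open>a\<close> and
  \<open>b\<close>.\<close>

lemma RO_chain_condition: "chain_condition (RO P) (\<subseteq>) (cardSuc |K| )"
  unfolding chain_condition_def
proof (intro allI impI)
  fix A assume A: "A \<subseteq> RO P - {bzero (RO P) (\<subseteq>)} \<and>
    (\<forall>a\<in>A. \<forall>b\<in>A. a \<noteq> b \<longrightarrow> bmeet (RO P) (\<subseteq>) a b = bzero (RO P) (\<subseteq>))"
  have AR: "a \<in> RO P" "a \<noteq> {}" if "a \<in> A" for a using A that by (auto simp: bzero_RO)
  have disj: "a \<inter> b = {}" if "a \<in> A" "b \<in> A" "a \<noteq> b" for a b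
    using A that bmeet_RO[OF AR(1) AR(1)] by (metis bzero_RO)
  define f where "f a = (SOME p. p \<in> a)" for a :: "'a set set"
  have f: "f a \<in> a" if "a \<in> A" for a using AR(2)[OF that] unfolding f_def by (meson ex_in_conv someI_ex)
  have "f a \<union> f b \<notin> P" if "a \<in> A" "b \<in> A" "a \<noteq> b" for a b
    using RO_up[OF AR(1) f, of a "f a \<union> f b"] RO_up[OF AR(1) f, of b "f a \<union> f b"] disj[OF that] that by auto
  moreover have fP: "f a \<in> P" if "a \<in> A" for a using RO_sub[OF AR(1)[OF that] f[OF that]] .
  ultimately have "antichain (f ` A)" unfolding antichain_def by blast
  then have "|f ` A| \<le>o |K|" by (rule antichain_card)
  moreover have "inj_on f A" using disj f by (metis disjoint_iff inj_onI)
  then have "|A| \<le>o |f ` A|" using card_of_ordLeq by blast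
  ultimately have "|A| \<le>o |K|" using ordLeq_transitive by blast
  then show "|A| <o cardSuc |K|"
    using cardSuc_ordLeq_ordLess[OF card_of_Card_order card_of_Card_order] by blast
qed

text \<open>A regular set is recovered from any maximal antichain inside it.\<close>

definition incomp :: "'a set set \<Rightarrow> 'a set set" where
  "incomp W = {p\<in>P. \<forall>w\<in>W. p \<union> w \<notin> P}"

text \<open>Zorn's lemma gives a maximal antichain \<open>W\<close> inside \<open>A\<close>. A
  condition incompatible with all of \<open>W\<close> has no extension in \<open>A\<close>, for such
  an extension could be added to \<open>W\<close>. Hence \<open>W\<close> determines
  \<open>perp P A\<close> and, by double complement, \<open>A\<close>.\<close>

lemma max_antichain:
  assumes A: "A \<in> RO P"
  shows "\<exists>W\<subseteq>A. |W| \<le>o |K| \<and> perp P A = incomp W"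
proof -
  let ?Z = "{W. antichain W \<and> W \<subseteq> A}"
  have "\<exists>W\<in>?Z. \<forall>Y\<in>?Z. W \<subseteq> Y \<longrightarrow> Y = W"
  proof (rule subset_Zorn)
    fix c assume c: "subset.chain ?Z c"
    have sub: "c \<subseteq> ?Z" using c unfolding subset_chain_def by simp
    have tot: "x \<subseteq> y \<or> y \<subseteq> x" if "x \<in> c" "y \<in> c" for x y
      using c that unfolding subset_chain_def by simp
    have "antichain (\<Union>c)"
      unfolding antichain_def
    proof (intro conjI ballI impI)
      show "\<Union>c \<subseteq> P" using sub unfolding antichain_def by blast
      fix p q assume "p \<in> \<Union>c" "q \<in> \<Union>c" and "p \<noteq> q"
      then obtain x y where xy: "x \<in> c" "y \<in> c" "p \<in> x" "q \<in> y" by blast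
      then obtain z where "z \<in> c" "p \<in> z" "q \<in> z" using tot[of x y] by blast
      moreover have "antichain z" using calculation sub by blast
      ultimately show "p \<union> q \<notin> P" using \<open>p \<noteq> q\<close> unfolding antichain_def by blast
    qed
    moreover have "\<Union>c \<subseteq> A" using sub by blast
    moreover have "\<forall>x\<in>c. x \<subseteq> \<Union>c" by blast
    ultimately show "\<exists>u\<in>?Z. \<forall>x\<in>c. x \<subseteq> u" by (intro bexI[of _ "\<Union>c"]) simp_all
  qed
  then obtain W where W: "antichain W" "W \<subseteq> A" and max: "\<And>Y. antichain Y \<Longrightarrow> Y \<subseteq> A \<Longrightarrow> W \<subseteq> Y \<Longrightarrow> Y = W"
    by auto
  have "perp P A = incomp W"
  proof
    show "perp P A \<subseteq> incomp W"
    proof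
      fix p assume p: "p \<in> perp P A"
      have "p \<union> w \<notin> P" if "w \<in> W" for w
        using RO_up[OF A, of w "p \<union> w"] W(2) that perpD[OF p, of "p \<union> w"] by auto
      then show "p \<in> incomp W" using p perp_sub unfolding incomp_def by blast
    qed
    show "incomp W \<subseteq> perp P A"
    proof
      fix p assume p: "p \<in> incomp W"
      show "p \<in> perp P A"
      proof (rule perpI)
        show "p \<in> P" using p unfolding incomp_def by simp
        fix a assume a: "a \<in> A" "p \<preceq> a"
        have aP: "a \<in> P" using RO_sub[OF A a(1)] .
        have inc: "a \<union> w \<notin> P" if "w \<in> W" for w
        proof
          assume "a \<union> w \<in> P"
          then have "p \<union> w \<in> P" using a(2) P_sub[of "a \<union> w" "p \<union> w"] unfolding weaker_def by blast
          then show False using p that unfolding incomp_def by blast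
        qed
        then have "antichain (insert a W)" using W(1) aP unfolding antichain_def by (auto simp: Un_commute)
        then have "insert a W = W" using max[of "insert a W"] a(1) W(2) by blast
        then show False using inc[of a] aP by auto
      qed
    qed
  qed
  then show ?thesis using W antichain_card by blast
qed

lemma perp_perp: assumes A: "A \<in> RO P" shows "perp P (perp P A) = A"
proof -
  have "reg_closure P (perp P A \<union> A) = P" using perp_dense[OF A] by (simp add: Un_commute)
  then show ?thesis using perp_unique[OF perp_RO[OF A] A] perp_disj[of A P] by (simp add: Int_commute)
qed

lemma card_P:
  assumes "infinite M" "|L| \<le>o |M|" "|K| \<le>o |M|" shows "|P| \<le>o |M|"
proof -
  have "inj_on (\<lambda>x. (col x, lev x, sv x, nv x)) X" by (rule inj_onI) (auto intro: point_eq)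
  moreover have "(\<lambda>x. (col x, lev x, sv x, nv x)) ` X \<subseteq> M \<times> L \<times> Fpow K \<times> UNIV" using col_M lev_L sv_K by auto
  ultimately have "|X| \<le>o |M \<times> L \<times> Fpow K \<times> (UNIV::nat set)|" using card_of_ordLeq by blast
  moreover have "|Fpow K| \<le>o |M|" using card_of_Fpow_le[OF K_inf] assms(3) ordLeq_transitive by blast
  then have "|M \<times> L \<times> Fpow K \<times> (UNIV::nat set)| \<le>o |M|"
    using assms nat_le_infinite[OF assms(1)] ordLeq_refl[OF card_of_Card_order, of M]
    by (intro card_of_Times_le) simp_all
  ultimately have X: "|X| \<le>o |M|" using ordLeq_transitive by blast
  have PX: "P \<subseteq> Fpow X" unfolding P_def Fpow_def by blast
  show ?thesis
  proof (cases "finite X")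
    case True
    then have "finite P" using finite_subset[OF PX] by (simp add: Fpow_def)
    then show ?thesis using card_of_finite_le assms(1) by blast
  next
    case False
    then show ?thesis using card_of_subset_le[OF PX] card_of_Fpow_le X ordLeq_transitive by blast
  qed
qed

text \<open>By \<open>max_antichain\<close> and \<open>perp_perp\<close> every element is
  \<open>perp P (incomp W)\<close> for a set \<open>W\<close> of at most \<open>|K|\<close>
  conditions, and there are at most \<open>|M|\<close> such \<open>W\<close>.\<close>

lemma card_RO:
  assumes "infinite M" "|L| \<le>o |M|" "|K| \<le>o |M|" "|M| ^c |K| =o |M|" shows "|RO P| \<le>o |M|"
proof -
  have "RO P \<subseteq> (\<lambda>W. perp P (incomp W)) ` {W. W \<subseteq> P \<and> |W| \<le>o |K| }"
  proof
    fix A assume A: "A \<in> RO P"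
    then obtain W where "W \<subseteq> A" "|W| \<le>o |K|" "perp P A = incomp W" using max_antichain by blast
    moreover have "W \<subseteq> P" using calculation RO_sub[OF A] by blast
    ultimately show "A \<in> (\<lambda>W. perp P (incomp W)) ` {W. W \<subseteq> P \<and> |W| \<le>o |K| }" using perp_perp[OF A]
      by (intro image_eqI[of _ _ W]) auto
  qed
  moreover have "|{W. W \<subseteq> P \<and> |W| \<le>o |K| }| \<le>o |M|"
    using card_of_small_subsets_le[OF assms(1) _ assms(4)] card_P[OF assms(1-3)] K_inf by fastforce
  ultimately show ?thesis by (rule card_of_subset_le[OF _ card_of_image_le])
qed

text \<open>Choose \<open>W\<close> with \<open>perp P A = incomp W\<close> and let \<open>S\<close>
  collect the levels occurring in it. If \<open>J\<close> contains \<open>S\<close>, then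
  \<open>restr J\<close> fixes each \<open>w\<close> in \<open>W\<close>, so by
  \<open>restr_Un_P\<close> restriction preserves incompatibility with \<open>W\<close>. Thus
  \<open>perp P A\<close> is supported on \<open>J\<close>, and so is its complement
  \<open>A\<close>.\<close>

lemma support:
  assumes A: "A \<in> RO P"
  shows "\<exists>S\<subseteq>L. |S| \<le>o |K| \<and> (\<forall>J. S \<subseteq> J \<longrightarrow> A \<in> level_alg J)"
proof -
  obtain W where W: "W \<subseteq> A" "|W| \<le>o |K|" "perp P A = incomp W" using max_antichain[OF A] by blast
  have WP: "W \<subseteq> P" using W(1) RO_sub[OF A] by blast
  define S where "S = lev ` \<Union>W"
  have SL: "S \<subseteq> L" unfolding S_def using WP P_X lev_L by blast
  have "|\<Union>w\<in>W. w| \<le>o |K|"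
    using W(2) WP card_of_finite_le[OF K_inf] unfolding P_def
    by (intro card_of_UNION_ordLeq_infinite[OF K_inf]) auto
  then have SK: "|S| \<le>o |K|" unfolding S_def by (intro card_of_image_le) simp
  have "perp P A \<in> level_alg J" if J: "S \<subseteq> J" for J
  proof -
    have "restr J p \<in> incomp W" if p: "p \<in> incomp W" for p
      unfolding incomp_def
    proof (intro CollectI conjI ballI)
      have pP: "p \<in> P" using p unfolding incomp_def by simp
      then show "restr J p \<in> P" by (rule restr_P)
      fix w assume w: "w \<in> W"
      have "restr J w = w" using w J unfolding restr_def S_def by blast
      show "restr J p \<union> w \<notin> P"
      proof
        assume "restr J p \<union> w \<in> P"
        then have "p \<union> w \<in> P" using restr_Un_P[OF pP, of w J] w WP \<open>restr J w = w\<close> by (auto simp: Un_commute)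
        then show False using p w unfolding incomp_def by simp
      qed
    qed
    then show ?thesis unfolding level_alg_def using perp_RO[OF A] W(3) by simp
  qed
  then have "A \<in> level_alg J" if "S \<subseteq> J" for J using level_alg_perp[of "perp P A" J] perp_perp[OF A] that by metis
  then show ?thesis using SL SK by blast
qed

text \<open>Each support has size at most \<open>|K|\<close> and is bounded in \<open>L\<close> by
  regularity; fewer than \<open>|L|\<close> such bounds are again bounded.\<close>

lemma bounded_support:
  assumes reg: "regularCard |L|" "|K| <o |L|" and I: "|I| <o |L|" and A: "\<And>i. i \<in> I \<Longrightarrow> A i \<in> RO P"
  shows "\<exists>\<alpha>\<in>L. \<forall>i\<in>I. A i \<in> level_alg (underS (card_of L) \<alpha>)"
proof -
  have L: "infinite L" using reg(2) K_inf card_of_ordLeq_infinite ordLess_imp_ordLeq by blast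
  have "\<exists>\<alpha>\<in>L. A i \<in> level_alg (underS (card_of L) \<alpha>)" if i: "i \<in> I" for i
  proof -
    obtain S where S: "S \<subseteq> L" "|S| \<le>o |K|" "\<And>J. S \<subseteq> J \<Longrightarrow> A i \<in> level_alg J" using support[OF A[OF i]] by blast
    then have "|S| <o |L|" using reg(2) ordLeq_ordLess_trans by blast
    then show ?thesis using regular_bound[OF reg(1) L S(1)] S(3) by blast
  qed
  then obtain f where f: "\<And>i. i \<in> I \<Longrightarrow> f i \<in> L \<and> A i \<in> level_alg (underS (card_of L) (f i))" by metis
  have "|f ` I| <o |L|" using card_of_image I ordLeq_ordLess_trans by blast
  moreover have "f ` I \<subseteq> L" using f by blast
  ultimately obtain \<alpha> where \<alpha>: "\<alpha> \<in> L" "f ` I \<subseteq> underS (card_of L) \<alpha>" using regular_bound[OF reg(1) L] by blast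
  have wo: "wo_rel |L|" by (simp add: wo_rel_def card_of_Well_order)
  have "A i \<in> level_alg (underS (card_of L) \<alpha>)" if i: "i \<in> I" for i
  proof -
    have "(f i, \<alpha>) \<in> |L|" using \<alpha>(2) i unfolding underS_def by blast
    then have "underS (card_of L) (f i) \<subseteq> underS (card_of L) \<alpha>"
      by (rule underS_incr[OF wo_rel.TRANS[OF wo] wo_rel.ANTISYM[OF wo]])
    then show ?thesis using level_alg_mono f[OF i] by blast
  qed
  then show ?thesis using \<alpha>(1) by blast
qed

end

section \<open>The ultrafilter\<close>

context conditions
begin

section \<open>Traces on initial segments of the levels, and the recursion along
  \<open>L\<close>\<close>

abbreviation below :: "'l \<Rightarrow> 'l set" where
  "below \<alpha> \<equiv> underS (card_of L) \<alpha>"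

abbreviation upto_lev :: "'l \<Rightarrow> 'l set" where
  "upto_lev \<alpha> \<equiv> insert \<alpha> (below \<alpha>)"

lemma wo_L: "wo_rel |L|"
  by (simp add: wo_rel_def card_of_Well_order)

lemma below_L: "\<alpha> \<in> below \<beta> \<Longrightarrow> \<alpha> \<in> L \<and> \<beta> \<in> L"
  using Field_card_of[of L] unfolding underS_def Field_def by blast

lemma below_irrefl: "\<alpha> \<notin> below \<alpha>"
  unfolding underS_def by simp

lemma below_total: "\<alpha> \<in> L \<Longrightarrow> \<beta> \<in> L \<Longrightarrow> \<alpha> = \<beta> \<or> \<alpha> \<in> below \<beta> \<or> \<beta> \<in> below \<alpha>"
  using wo_rel.TOTALS[OF wo_L] unfolding underS_def Field_card_of by blast

lemma below_mono: "\<alpha> \<in> below \<beta> \<Longrightarrow> below \<alpha> \<subseteq> below \<beta>"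
  by (rule underS_incr[OF wo_rel.TRANS[OF wo_L] wo_rel.ANTISYM[OF wo_L]]) (simp add: underS_def)

lemma upto_lev_below: "\<alpha> \<in> below \<beta> \<Longrightarrow> upto_lev \<alpha> \<subseteq> below \<beta>"
  using below_mono by simp

text \<open>\<open>level_alg J\<close> is closed under complements, so the trace of \<open>U\<close>
  on it is an ultrafilter of this subalgebra and cannot be properly enlarged to the trace of
  \<open>V\<close>.\<close>

lemma ultra_agree:
  assumes "ultra P U" "ultra P V" "U \<inter> level_alg J \<subseteq> V" shows "V \<inter> level_alg J = U \<inter> level_alg J"
proof
  show "V \<inter> level_alg J \<subseteq> U \<inter> level_alg J"
  proof
    fix a assume a: "a \<in> V \<inter> level_alg J"
    then have aR: "a \<in> RO P" using level_alg_RO by blast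
    have "perp P a \<in> level_alg J" using a level_alg_perp by blast
    then have "perp P a \<notin> U" using assms(3) ultra_perp[OF assms(2) aR] a by blast
    then show "a \<in> U \<inter> level_alg J" using ultra_perp[OF assms(1) aR] a by blast
  qed
qed (use assms(3) in blast)

text \<open>By coherence two members of the traces both belong to the trace with the larger index,
  so the union of the traces generates a proper filter; \<open>P\<close> is added to cover an empty
  \<open>I\<close>. This serves every stage of the recursion and, with \<open>I = L\<close>, its
  end.\<close>

lemma coherent_limit:
  assumes I: "I \<subseteq> L" and f: "\<And>\<beta>. \<beta> \<in> I \<Longrightarrow> ultra P (f \<beta>)"
    and coh: "\<And>\<beta> \<gamma>. \<beta> \<in> I \<Longrightarrow> \<gamma> \<in> I \<Longrightarrow> \<gamma> \<in> below \<beta> \<Longrightarrow> f \<gamma> \<inter> level_alg (upto_lev \<gamma>) \<subseteq> f \<beta>"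
  shows "\<exists>W. ultra P W \<and> (\<forall>\<beta>\<in>I. f \<beta> \<inter> level_alg (upto_lev \<beta>) \<subseteq> W)"
proof -
  define S where "S = insert P (\<Union>\<beta>\<in>I. f \<beta> \<inter> level_alg (upto_lev \<beta>))"
  have SR: "S \<subseteq> RO P" unfolding S_def using RO_P level_alg_RO by blast
  have "pfilter P {b\<in>RO P. \<exists>a\<in>S. a \<subseteq> b}"
  proof (rule filter_base_pfilter[OF SR])
    show "S \<noteq> {}" unfolding S_def by simp
    have "P \<noteq> {}" using P_empty by blast
    then show "{} \<notin> S" unfolding S_def using ultra_empty[OF f] by blast
    have mem: "a \<inter> b \<in> S" if "\<beta> \<in> I" "\<gamma> \<in> I" "\<gamma> \<in> upto_lev \<beta>" "a \<in> f \<beta> \<inter> level_alg (upto_lev \<beta>)" "b \<in> f \<gamma> \<inter> level_alg (upto_lev \<gamma>)" for a b \<beta> \<gamma>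
    proof -
      have "b \<in> f \<beta>" using that coh[of \<beta> \<gamma>] by blast
      moreover have "upto_lev \<gamma> \<subseteq> upto_lev \<beta>" using that(3) upto_lev_below by blast
      then have "b \<in> level_alg (upto_lev \<beta>)" using level_alg_mono that(5) by blast
      ultimately have "a \<inter> b \<in> f \<beta> \<inter> level_alg (upto_lev \<beta>)" using that(1,4) ultra_Int[OF f] level_alg_Int by simp
      then show ?thesis unfolding S_def using that(1) by blast
    qed
    fix a b assume ab: "a \<in> S" "b \<in> S"
    have "a \<inter> b \<in> S"
    proof (cases "a = P \<or> b = P")
      case True
      then have "a \<inter> b = a \<or> a \<inter> b = b" using SR ab unfolding RO_def by blast
      then show ?thesis using ab by metis
    next
      case False
      then obtain \<beta> \<gamma> where *: "\<beta> \<in> I" "\<gamma> \<in> I" "a \<in> f \<beta> \<inter> level_alg (upto_lev \<beta>)" "b \<in> f \<gamma> \<inter> level_alg (upto_lev \<gamma>)"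
        using ab unfolding S_def by blast
      then consider "\<gamma> \<in> upto_lev \<beta>" | "\<beta> \<in> upto_lev \<gamma>" using below_total[of \<beta> \<gamma>] I by blast
      then show ?thesis
      proof cases
        case 1 then show ?thesis using mem[OF *(1,2)] * by blast
      next
        case 2 then show ?thesis using mem[OF *(2,1) _ *(4,3)] by (simp add: Int_commute)
      qed
    qed
    then show "\<exists>c\<in>S. c \<subseteq> a \<inter> b" by blast
  qed
  from pfilter_ultra[OF this] obtain W where W: "ultra P W" "{b\<in>RO P. \<exists>a\<in>S. a \<subseteq> b} \<subseteq> W"
    by (elim exE conjE)
  have "S \<subseteq> W"
  proof
    fix a assume "a \<in> S"
    then have "a \<in> {b\<in>RO P. \<exists>a\<in>S. a \<subseteq> b}" using SR by auto
    then show "a \<in> W" using W(2) by (rule subsetD[rotated])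
  qed
  then show ?thesis using W(1) unfolding S_def by blast
qed

text \<open>Well-founded recursion along \<open>L\<close>: the earlier traces are combined into an
  ultrafilter \<open>W\<close>, which is then replaced by one containing the step filter over the
  trace of \<open>W\<close> below \<open>\<alpha>\<close>. A last limit joins all stages.\<close>

lemma generic_ultra_exists:
  "\<exists>U. ultra P U \<and> (\<forall>\<alpha>\<in>L. step_filter (U \<inter> level_alg (below \<alpha>)) \<alpha> \<inter> level_alg (upto_lev \<alpha>) \<subseteq> U)"
proof -
  \<comment> \<open>Each stage is an ultrafilter of the whole algebra, but only its trace on the
    levels up to its own is handed on. The guard \<open>\<alpha> \<in> L\<close> lets the recursion
    run over the whole type \<open>'l\<close>.\<close>
  define Q where "Q f \<alpha> V \<longleftrightarrow> ultra P V \<and> (\<forall>\<beta>\<in>below \<alpha>. f \<beta> \<inter> level_alg (upto_lev \<beta>) \<subseteq> V) \<and>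
    (\<alpha> \<in> L \<longrightarrow> step_filter (V \<inter> level_alg (below \<alpha>)) \<alpha> \<subseteq> V)" for f \<alpha> V
  have "\<exists>f. \<forall>\<alpha>. Q f \<alpha> (f \<alpha>)"
  proof (rule dependent_wf_choice[OF wo_rel.WF[OF wo_L]])
    fix f g :: "'l \<Rightarrow> 'a set set set" and \<alpha> V
    assume "\<And>\<beta>. (\<beta>, \<alpha>) \<in> |L| - Id \<Longrightarrow> f \<beta> = g \<beta>"
    then have "f \<beta> = g \<beta>" if "\<beta> \<in> below \<alpha>" for \<beta> using that unfolding underS_def by simp
    then show "Q f \<alpha> V = Q g \<alpha> V" unfolding Q_def by simp
  next
    fix f \<alpha>
    assume "\<And>\<beta>. (\<beta>, \<alpha>) \<in> |L| - Id \<Longrightarrow> Q f \<beta> (f \<beta>)"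
    then have IH: "Q f \<beta> (f \<beta>)" if "\<beta> \<in> below \<alpha>" for \<beta> using that unfolding underS_def by simp
    have "\<exists>W. ultra P W \<and> (\<forall>\<beta>\<in>below \<alpha>. f \<beta> \<inter> level_alg (upto_lev \<beta>) \<subseteq> W)"
      by (rule coherent_limit) (use IH below_L in \<open>auto simp: Q_def\<close>)
    then obtain W where W: "ultra P W" "\<And>\<beta>. \<beta> \<in> below \<alpha> \<Longrightarrow> f \<beta> \<inter> level_alg (upto_lev \<beta>) \<subseteq> W" by blast
    show "\<exists>V. Q f \<alpha> V"
    proof (cases "\<alpha> \<in> L")
      case False
      then have "Q f \<alpha> W" unfolding Q_def using W by blast
      then show ?thesis ..
    next
      case True
      let ?V = "W \<inter> level_alg (below \<alpha>)"
      have "pfilter P (step_filter ?V \<alpha>)" and sub: "?V \<subseteq> step_filter ?V \<alpha>"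
        using ultra_P[OF W(1)] ultra_empty[OF W(1)] ultra_Int[OF W(1)] True below_irrefl level_alg_P level_alg_Int
        by (intro step_filter_pfilter[of _ "below \<alpha>"]; simp)+
      then obtain U where U: "ultra P U" "step_filter ?V \<alpha> \<subseteq> U" using pfilter_ultra by blast
      \<comment> \<open>In \<open>Q\<close> the step filter is taken over the trace of the new
        ultrafilter, so the passage from \<open>W\<close> to \<open>U\<close> must leave the trace
        below \<open>\<alpha>\<close> unchanged.\<close>
      have "U \<inter> level_alg (below \<alpha>) = ?V" using ultra_agree[OF W(1) U(1)] sub U(2) by blast
      moreover have "f \<beta> \<inter> level_alg (upto_lev \<beta>) \<subseteq> U" if "\<beta> \<in> below \<alpha>" for \<beta>
        using W(2)[OF that] level_alg_mono[OF upto_lev_below[OF that]] sub U(2) by blast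
      ultimately have "Q f \<alpha> U" unfolding Q_def using U by simp
      then show ?thesis ..
    qed
  qed
  then obtain f where f: "\<And>\<alpha>. Q f \<alpha> (f \<alpha>)" by blast
  have "\<exists>W. ultra P W \<and> (\<forall>\<beta>\<in>L. f \<beta> \<inter> level_alg (upto_lev \<beta>) \<subseteq> W)"
    by (rule coherent_limit) (use f in \<open>auto simp: Q_def\<close>)
  then obtain U where U: "ultra P U" "\<And>\<alpha>. \<alpha> \<in> L \<Longrightarrow> f \<alpha> \<inter> level_alg (upto_lev \<alpha>) \<subseteq> U" by blast
  have "step_filter (U \<inter> level_alg (below \<alpha>)) \<alpha> \<inter> level_alg (upto_lev \<alpha>) \<subseteq> U" if \<alpha>: "\<alpha> \<in> L" for \<alpha>
  proof -
    have "level_alg (below \<alpha>) \<subseteq> level_alg (upto_lev \<alpha>)" using level_alg_mono[of "below \<alpha>" "upto_lev \<alpha>"] by blast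
    then have "f \<alpha> \<inter> level_alg (below \<alpha>) \<subseteq> U" using U(2)[OF \<alpha>] by blast
    then have "U \<inter> level_alg (below \<alpha>) = f \<alpha> \<inter> level_alg (below \<alpha>)" using ultra_agree U(1) f[of \<alpha>] unfolding Q_def by blast
    then have "step_filter (U \<inter> level_alg (below \<alpha>)) \<alpha> \<subseteq> f \<alpha>" using f[of \<alpha>] \<alpha> unfolding Q_def by simp
    then show ?thesis using U(2)[OF \<alpha>] by blast
  qed
  then show ?thesis using U(1) by blast
qed

end

section \<open>Goodness and the generic numbers\<close>

locale generic_ultra = conditions X col lev sv nv M L K
  for X :: "'a set" and col :: "'a \<Rightarrow> 'm" and lev :: "'a \<Rightarrow> 'l" and sv :: "'a \<Rightarrow> 'k set"
    and nv :: "'a \<Rightarrow> nat" and M :: "'m set" and L :: "'l set" and K :: "'k set" +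
  fixes U :: "'a set set set"
  assumes ultraU: "ultra P U"
    and step_U: "\<alpha> \<in> L \<Longrightarrow> step_filter (U \<inter> level_alg (below \<alpha>)) \<alpha> \<inter> level_alg (upto_lev \<alpha>) \<subseteq> U"
    and K_L: "|K| <o |L|" and L_M: "|L| \<le>o |M|" and M_K: "|M| ^c |K| =o |M|" and regL: "regularCard |L|"
begin

lemma L_inf: "infinite L"
  using card_of_ordLeq_infinite[OF ordLess_imp_ordLeq[OF K_L] K_inf] .

lemma M_inf: "infinite M"
  using card_of_ordLeq_infinite[OF L_M L_inf] .

lemma K_M: "|K| \<le>o |M|"
  using ordLeq_transitive[OF ordLess_imp_ordLeq[OF K_L] L_M] .

text \<open>The form in which genericity is applied: for an arbitrary generic \<open>q\<close> it
  suffices to find one set in the trace of \<open>U\<close> below the level whose members above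
  \<open>q\<close> all lie in \<open>Y\<close>.\<close>

lemma in_U:
  assumes "\<alpha> \<in> L" "Y \<in> level_alg (upto_lev \<alpha>)" "finite F" "F \<subseteq> M" "t \<in> Fpow K"
    and "\<And>q. generic_cond \<alpha> F t N q \<Longrightarrow> \<exists>a\<in>U \<inter> level_alg (below \<alpha>). \<forall>p\<in>a. q \<preceq> p \<longrightarrow> p \<in> Y"
  shows "Y \<in> U"
proof -
  have "Y \<in> step_filter (U \<inter> level_alg (below \<alpha>)) \<alpha>"
    using step_filterI[OF level_alg_RO[OF assms(2)] assms(3-5), of \<alpha> N] assms(6) by blast
  then show ?thesis using step_U[OF assms(1)] assms(2) by blast
qed

lemma P_in_U: "P \<in> U \<inter> level_alg J"
  using ultra_P[OF ultraU] level_alg_P by blast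

lemma empty_Fpow: "{} \<in> Fpow K"
  by (simp add: Fpow_def)

lemma generic_cond_slot: "generic_cond \<alpha> F t N q \<Longrightarrow> i \<in> F \<Longrightarrow> \<exists>x\<in>q. slot x = (i, \<alpha>) \<and> t \<subseteq> sv x \<and> N \<le> nv x"
  unfolding generic_cond_def slot_def by auto

text \<open>A generic \<open>q\<close> with parameter \<open>t\<close> decides the set value as some
  \<open>sv x\<close> containing \<open>t\<close>. The set \<open>A (sv x)\<close> is in
  \<open>U\<close>, and its conditions above \<open>q\<close> lie in the term for
  \<open>s = sv x\<close> of the join defining \<open>mult_ref\<close>.\<close>

lemma mult_ref_in_U:
  assumes \<alpha>: "\<alpha> \<in> L" and i: "i \<in> M" and t: "t \<in> Fpow K"
    and A: "\<And>s. s \<in> Fpow K \<Longrightarrow> A s \<in> U \<inter> level_alg (below \<alpha>)"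
  shows "mult_ref A i \<alpha> t \<in> U"
proof (rule in_U[OF \<alpha> _ _ _ t])
  have AD: "A s \<in> level_alg (upto_lev \<alpha>)" if "s \<in> Fpow K" for s using A[OF that] level_alg_mono[of "below \<alpha>" "upto_lev \<alpha>"] by blast
  then show "mult_ref A i \<alpha> t \<in> level_alg (upto_lev \<alpha>)" using mult_ref_level_alg[OF i \<alpha>] by simp
  show "finite {i}" "{i} \<subseteq> M" using i by simp_all
  fix q assume q: "generic_cond \<alpha> {i} t 0 q"
  then obtain x where x: "x \<in> q" "slot x = (i, \<alpha>)" "t \<subseteq> sv x" using generic_cond_slot by blast
  have "x \<in> X" using P_X q x(1) unfolding generic_cond_def by blast
  then have sx: "sv x \<in> Fpow K" using sv_K by blast
  have "p \<in> mult_ref A i \<alpha> t" if p: "p \<in> A (sv x)" "q \<preceq> p" for p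
  proof -
    have pP: "p \<in> P" using RO_sub[OF level_alg_RO[OF AD[OF sx]] p(1)] .
    have xp: "x \<in> p" using weaker_mem[OF p(2) x(1)] .
    have "p \<in> A (sv x) \<inter> set_val i \<alpha> (sv x)" using p(1) set_val_mem[OF xp pP x(2)] by simp
    then have pS: "p \<in> \<Union>{A s \<inter> set_val i \<alpha> s | s. s \<in> Fpow K \<and> t \<subseteq> s}" using sx x(3) by blast
    have "{A s \<inter> set_val i \<alpha> s | s. s \<in> Fpow K \<and> t \<subseteq> s} \<subseteq> RO P"
      using level_alg_RO[OF AD] level_alg_RO[OF set_val_level_alg[OF i \<alpha> \<alpha>]] RO_Int by blast
    from reg_closure_upper[OF Union_sub[OF this] up_closed_Union[OF this]] show ?thesis
      unfolding mult_ref_def using pS by (rule subsetD)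
  qed
  then show "\<exists>a\<in>U \<inter> level_alg (below \<alpha>). \<forall>p\<in>a. q \<preceq> p \<longrightarrow> p \<in> mult_ref A i \<alpha> t" using A[OF sx] by blast
qed

text \<open>A distribution has at most \<open>|K|\<close> values, so by
  \<open>bounded_support\<close> they all live below some level \<open>\<alpha>\<close>, and any
  column on that level yields a refinement.\<close>

lemma good_U: "good (RO P) (\<subseteq>) U K"
  unfolding good_def
proof (intro allI impI)
  fix A assume A: "distribution (RO P) (\<subseteq>) K A \<and> distribution_in K U A"
  then have AR: "A s \<in> RO P" if "s \<in> Fpow K" for s using that unfolding distribution_def Fpow_def by simp
  have AU: "A s \<in> U" if "s \<in> Fpow K" for s using A that unfolding distribution_in_def Fpow_def by simp
  have "|Fpow K| <o |L|" using ordLeq_ordLess_trans[OF card_of_Fpow_le[OF K_inf] K_L] .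
  then obtain \<alpha> where \<alpha>: "\<alpha> \<in> L" "\<And>s. s \<in> Fpow K \<Longrightarrow> A s \<in> level_alg (below \<alpha>)"
    using bounded_support[OF regL K_L, of "Fpow K" A] AR by blast
  obtain i where i: "i \<in> M" using M_inf by fastforce
  \<comment> \<open>The unit is prescribed at the empty set, since
    \<open>mult_ref A i \<alpha> {}\<close> need not equal it.\<close>
  define B where "B t = (if t = {} then P else mult_ref A i \<alpha> t)" for t
  have Bin: "B t \<in> U" if "t \<in> Fpow K" for t
    using mult_ref_in_U[OF \<alpha>(1) i that] AU \<alpha>(2) ultra_P[OF ultraU] unfolding B_def by simp
  have BR: "B t \<in> RO P" if "t \<in> Fpow K" for t using ultra_sub[OF ultraU Bin[OF that]] .
  have "distribution (RO P) (\<subseteq>) K B"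
    unfolding distribution_def
  proof (intro conjI allI impI)
    show "B {} = bone (RO P) (\<subseteq>)" unfolding B_def bone_RO by simp
    show "B s \<in> RO P" if "finite s \<and> s \<subseteq> K" for s using BR that unfolding Fpow_def by simp
    have "mult_ref A i \<alpha> t \<subseteq> P" for t unfolding mult_ref_def by (rule reg_closure_sub)
    then show "B t \<subseteq> B s" if "finite t \<and> t \<subseteq> K \<and> s \<subseteq> t" for s t
      using that mult_ref_mono[of s t A i \<alpha>] unfolding B_def by (cases "s = {}"; cases "t = {}") simp_all
  qed
  moreover have "multiplicative (RO P) (\<subseteq>) K B"
    unfolding multiplicative_def
  proof (intro allI impI)
    fix t assume t: "finite t \<and> t \<subseteq> K"
    then have tF: "t \<in> Fpow K" unfolding Fpow_def by simp
    have "(\<lambda>\<beta>. B {\<beta>}) ` t \<subseteq> RO P" using BR t unfolding Fpow_def by auto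
    then have *: "binf (RO P) (\<subseteq>) ((\<lambda>\<beta>. B {\<beta>}) ` t) = P \<inter> (\<Inter>\<beta>\<in>t. B {\<beta>})" by (rule binf_RO)
    show "B t = binf (RO P) (\<subseteq>) ((\<lambda>\<beta>. B {\<beta>}) ` t)"
    proof (cases "t = {}")
      case True then show ?thesis unfolding * by (simp add: B_def)
    next
      case False then show ?thesis unfolding * using mult_ref_multiplicative[OF AR i \<alpha>(1) tF] by (simp add: B_def)
    qed
  qed
  moreover have "refines (\<subseteq>) K B A"
    unfolding refines_def
  proof (intro allI impI)
    fix t assume "finite t \<and> t \<subseteq> K"
    then have t: "t \<in> Fpow K" unfolding Fpow_def by simp
    have "A {} = P" using A unfolding distribution_def bone_RO by simp
    then show "B t \<subseteq> A t" using mult_ref_le[OF conjunct1[OF A] t, of i \<alpha>] unfolding B_def by simp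
  qed
  moreover have "distribution_in K U B" using Bin unfolding distribution_in_def Fpow_def by simp
  ultimately show "\<exists>B. distribution (RO P) (\<subseteq>) K B \<and> multiplicative (RO P) (\<subseteq>) K B \<and>
    refines (\<subseteq>) K B A \<and> distribution_in K U B" by blast
qed

lemma num_D_upto: "i \<in> M \<Longrightarrow> \<alpha> \<in> L \<Longrightarrow> num i \<alpha> k \<in> level_alg (upto_lev \<alpha>)"
  by (rule num_level_alg) simp_all

lemma num_nonstd:
  assumes i: "i \<in> M" and \<alpha>: "\<alpha> \<in> L" shows "nonstd U (num i \<alpha>)"
  unfolding nonstd_def
proof
  fix k
  have "perp P (num i \<alpha> k) \<in> U"
  proof (rule in_U[OF \<alpha> _ _ _ empty_Fpow])
    show "perp P (num i \<alpha> k) \<in> level_alg (upto_lev \<alpha>)" by (rule level_alg_perp[OF num_D_upto[OF i \<alpha>]])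
    show "finite {i}" "{i} \<subseteq> M" using i by simp_all
    fix q assume q: "generic_cond \<alpha> {i} {} (Suc k) q"
    then obtain x where x: "x \<in> q" "slot x = (i, \<alpha>)" "Suc k \<le> nv x" using generic_cond_slot by blast
    have "p \<in> perp P (num i \<alpha> k)" if p: "p \<in> P" "q \<preceq> p" for p
    proof (rule perpI[OF p(1)])
      fix r assume r: "r \<in> num i \<alpha> k" "p \<preceq> r"
      have "r \<in> P" using r(1) RO_sub[OF parts_RO[OF num_parts[OF i \<alpha>]]] by blast
      moreover have "x \<in> r" using weaker_mem[OF r(2) weaker_mem[OF p(2) x(1)]] .
      ultimately have "nv x = k" using num_mem x(2) r(1) by blast
      then show False using x(3) by simp
    qed
    then show "\<exists>a\<in>U \<inter> level_alg (below \<alpha>). \<forall>p\<in>a. q \<preceq> p \<longrightarrow> p \<in> perp P (num i \<alpha> k)" using P_in_U by blast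
  qed
  then show "num i \<alpha> k \<notin> U" using ultra_perp[OF ultraU parts_RO[OF num_parts[OF i \<alpha>]]] by blast
qed

text \<open>A generic \<open>q\<close> fixes the number in column \<open>i\<close> as a standard
  \<open>nv x\<close>. As \<open>m\<close> is nonstandard, the truth value of
  \<open>nv x < m\<close> is in \<open>U\<close>, and it is supported below \<open>\<alpha>\<close>
  because \<open>m\<close> is; together with \<open>q\<close> it forces the inequality.\<close>

lemma num_less:
  assumes i: "i \<in> M" and \<alpha>: "\<alpha> \<in> L" and m: "m \<in> parts P" "nonstd U m" "\<And>k. m k \<in> level_alg (below \<alpha>)"
  shows "tv P (<) (num i \<alpha>) m \<in> U"
proof (rule in_U[OF \<alpha> _ _ _ empty_Fpow])
  have "m k \<in> level_alg (upto_lev \<alpha>)" for k using m(3)[of k] level_alg_mono[of "below \<alpha>" "upto_lev \<alpha>"] by blast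
  then show "tv P (<) (num i \<alpha>) m \<in> level_alg (upto_lev \<alpha>)" using level_alg_tv[OF num_parts[OF i \<alpha>] m(1) num_D_upto[OF i \<alpha>]] by blast
  show "finite {i}" "{i} \<subseteq> M" using i by simp_all
  fix q assume q: "generic_cond \<alpha> {i} {} 0 q"
  then obtain x where x: "x \<in> q" "slot x = (i, \<alpha>)" using generic_cond_slot by blast
  let ?a = "tv P (\<lambda>j k. nv x < j) m m"
  have "?a \<in> U" by (rule nonstd_gt[OF ultraU m(1,2)])
  moreover have "?a \<in> level_alg (below \<alpha>)" by (rule level_alg_tv[OF m(1,1) m(3,3)])
  moreover have "p \<in> tv P (<) (num i \<alpha>) m" if p: "p \<in> ?a" "q \<preceq> p" for p
  proof (rule tvI)
    show "p \<in> P" using p(1) tv_sub by blast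
    fix r j k assume r: "r \<in> P" "p \<preceq> r" "r \<in> num i \<alpha> j" "r \<in> m k"
    have "x \<in> r" using weaker_mem[OF r(2) weaker_mem[OF p(2) x(1)]] .
    then have "nv x = j" using num_mem[OF _ r(1) x(2)] r(3) by blast
    moreover have "nv x < k" using tvD[OF p(1) r(1,2,4,4)] .
    ultimately show "j < k" by simp
  qed
  ultimately show "\<exists>a\<in>U \<inter> level_alg (below \<alpha>). \<forall>p\<in>a. q \<preceq> p \<longrightarrow> p \<in> tv P (<) (num i \<alpha>) m" by blast
qed

text \<open>A generic condition covering both columns gives them different numbers, by injectivity
  of \<open>nv\<close>.\<close>

lemma num_distinct:
  assumes i: "i \<in> M" and j: "j \<in> M" and \<alpha>: "\<alpha> \<in> L" and ij: "i \<noteq> j"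
  shows "tv P (=) (num i \<alpha>) (num j \<alpha>) \<notin> U"
proof -
  let ?e = "tv P (=) (num i \<alpha>) (num j \<alpha>)"
  have "perp P ?e \<in> U"
  proof (rule in_U[OF \<alpha> _ _ _ empty_Fpow])
    show "perp P ?e \<in> level_alg (upto_lev \<alpha>)"
      by (rule level_alg_perp[OF level_alg_tv[OF num_parts[OF i \<alpha>] num_parts[OF j \<alpha>] num_D_upto[OF i \<alpha>] num_D_upto[OF j \<alpha>]]])
    show "finite {i, j}" "{i, j} \<subseteq> M" using i j by simp_all
    fix q assume q: "generic_cond \<alpha> {i, j} {} 0 q"
    obtain x where x: "x \<in> q" "slot x = (i, \<alpha>)" using generic_cond_slot[OF q] by blast
    obtain y where y: "y \<in> q" "slot y = (j, \<alpha>)" using generic_cond_slot[OF q] by blast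
    have "x \<noteq> y" using x y ij by auto
    then have neq: "nv x \<noteq> nv y" using q x(1) y(1) unfolding generic_cond_def inj_on_def by blast
    have "p \<in> perp P ?e" if p: "p \<in> P" "q \<preceq> p" for p
    proof (rule perpI[OF p(1)])
      fix r assume r: "r \<in> ?e" "p \<preceq> r"
      have rP: "r \<in> P" using r(1) tv_sub by blast
      have "x \<in> r" "y \<in> r" using weaker_mem[OF r(2) weaker_mem[OF p(2)]] x(1) y(1) by blast+
      then have "r \<in> num i \<alpha> (nv x)" "r \<in> num j \<alpha> (nv y)"
        using num_mem[OF _ rP x(2)] num_mem[OF _ rP y(2)] by blast+
      then show False using tvD[OF r(1) rP weaker_refl] neq by blast
    qed
    then show "\<exists>a\<in>U \<inter> level_alg (below \<alpha>). \<forall>p\<in>a. q \<preceq> p \<longrightarrow> p \<in> perp P ?e" using P_in_U by blast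
  qed
  then show ?thesis using ultra_perp[OF ultraU tv_RO[OF num_parts[OF i \<alpha>] num_parts[OF j \<alpha>]]] by blast
qed

lemma parts_bounded:
  assumes m: "m \<in> parts P" shows "\<exists>\<alpha>\<in>L. \<forall>k. m k \<in> level_alg (below \<alpha>)"
proof -
  have "|UNIV :: nat set| <o |L|" using ordLeq_ordLess_trans[OF nat_le_infinite[OF K_inf] K_L] .
  then show ?thesis using bounded_support[OF regL K_L _ parts_RO[OF m], of UNIV id] by simp
qed

text \<open>The complements of the values of a nonstandard number are countably many members of
  \<open>U\<close>. No condition lies in all of them, since some extension decides the
  number.\<close>

lemma incomplete_U: "aleph1_incomplete (RO P) (\<subseteq>) U"
proof -
  obtain i \<alpha> where i: "i \<in> M" "\<alpha> \<in> L" using M_inf L_inf by fastforce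
  let ?n = "num i \<alpha>"
  note n = num_parts[OF i]
  let ?X = "range (\<lambda>k. perp P (?n k))"
  have "?X \<subseteq> U" using num_nonstd[OF i] ultra_perp[OF ultraU parts_RO[OF n]] unfolding nonstd_def by blast
  moreover have "countable ?X" by simp
  moreover have "binf (RO P) (\<subseteq>) ?X = {}"
  proof -
    have "?X \<subseteq> RO P" using perp_RO[OF parts_RO[OF n]] by blast
    then have *: "binf (RO P) (\<subseteq>) ?X = P \<inter> \<Inter>?X" by (rule binf_RO)
    have False if p: "p \<in> P" "\<And>k. p \<in> perp P (?n k)" for p
    proof -
      obtain q k where "p \<preceq> q" "q \<in> ?n k" using parts_ext[OF n p(1)] by blast
      then show False using perpD[OF p(2)] by blast
    qed
    then show ?thesis unfolding * by blast
  qed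
  ultimately show ?thesis unfolding aleph1_incomplete_def using ultra_empty[OF ultraU] by metis
qed

text \<open>A partition is a function from \<open>nat\<close> into the algebra, and
  \<open>|M| ^c |K| =o |M|\<close> with \<open>K\<close> infinite bounds the number of these
  functions.\<close>

lemma card_upw: "|upw P U| \<le>o |M|"
proof -
  have "parts P \<subseteq> Func UNIV (RO P)" unfolding Func_def using parts_RO by blast
  moreover have "|Func (UNIV :: nat set) (RO P)| \<le>o |M|"
    using K_inf by (intro card_of_Func_le[OF M_K nat_le_infinite[OF K_inf]] card_RO M_inf L_M K_M M_K) auto
  ultimately have "|parts P| \<le>o |M|" by (rule card_of_subset_le)
  then have "|cls P U ` parts P| \<le>o |M|" by (rule card_of_image_le)
  moreover have "upw P U \<subseteq> cls P U ` parts P" using upw_cases by blast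
  ultimately show ?thesis by (rule card_of_subset_le[rotated])
qed

section \<open>The two cardinal invariants of the Boolean power\<close>

lemma num_cls:
  assumes "i \<in> M" "\<alpha> \<in> L"
  shows "cls P U (num i \<alpha>) \<in> upw P U - upow_omega (RO P) (\<subseteq>) U"
  using cls_in[OF num_parts[OF assms]] omega_iff[OF ultraU num_parts[OF assms]] num_nonstd[OF assms] by blast

text \<open>A name has countably many values and is therefore supported below some level
  \<open>\<alpha>\<close>; by \<open>num_less\<close> all generic numbers from that level on are
  smaller. Both invariants are computed from this.\<close>

lemma nonstd_cls:
  assumes "c \<in> upw P U - upow_omega (RO P) (\<subseteq>) U"
  shows "\<exists>\<alpha>\<in>L. \<forall>\<beta>. \<alpha> = \<beta> \<or> \<alpha> \<in> below \<beta> \<longrightarrow> \<beta> \<in> L \<longrightarrow> (\<forall>i\<in>M. upl P U (cls P U (num i \<beta>)) c)"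
proof -
  obtain m where m: "m \<in> parts P" "c = cls P U m" using assms upw_cases by blast
  have ns: "nonstd U m" using assms omega_iff[OF ultraU m(1)] m(2) by blast
  obtain \<alpha> where \<alpha>: "\<alpha> \<in> L" "\<And>k. m k \<in> level_alg (below \<alpha>)" using parts_bounded[OF m(1)] by blast
  have "upl P U (cls P U (num i \<beta>)) c" if \<beta>: "\<alpha> = \<beta> \<or> \<alpha> \<in> below \<beta>" "\<beta> \<in> L" "i \<in> M" for i \<beta>
  proof -
    have "below \<alpha> \<subseteq> below \<beta>" using \<beta>(1) below_mono by blast
    then have "m k \<in> level_alg (below \<beta>)" for k using level_alg_mono \<alpha>(2) by blast
    then show ?thesis using upl_cls[OF ultraU num_parts[OF \<beta>(3,2)] m(1)] num_less[OF \<beta>(3,2) m(1) ns] m(2) by blast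
  qed
  then show ?thesis using \<alpha>(1) by blast
qed

text \<open>A nonstandard member has all the numbers of some level below it, and these form
  \<open>|M|\<close> different classes.\<close>

lemma card_init_seg:
  assumes I: "init_seg (upw P U) (upl P U) I" "upow_omega (RO P) (\<subseteq>) U \<subset> I"
  shows "|M| \<le>o |I|"
proof -
  obtain c where c: "c \<in> I" "c \<notin> upow_omega (RO P) (\<subseteq>) U" using I(2) by blast
  then have "c \<in> upw P U - upow_omega (RO P) (\<subseteq>) U" using I(1) unfolding init_seg_def by blast
  from nonstd_cls[OF this] obtain \<alpha> where \<alpha>: "\<alpha> \<in> L" "\<And>i. i \<in> M \<Longrightarrow> upl P U (cls P U (num i \<alpha>)) c" by blast
  let ?f = "\<lambda>i. cls P U (num i \<alpha>)"
  have "?f i \<in> I" if i: "i \<in> M" for i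
    using I(1) c(1) \<alpha>(2)[OF i] num_cls[OF i \<alpha>(1)] unfolding init_seg_def by blast
  then have "?f ` M \<subseteq> I" by blast
  moreover have "inj_on ?f M"
  proof (rule inj_onI)
    fix i j assume ij: "i \<in> M" "j \<in> M" "?f i = ?f j"
    then have "tv P (=) (num i \<alpha>) (num j \<alpha>) \<in> U"
      using cls_eq[OF ultraU num_parts num_parts] \<alpha>(1) by blast
    then show "i = j" using num_distinct[OF ij(1,2) \<alpha>(1)] by blast
  qed
  ultimately show ?thesis using card_of_ordLeq by blast
qed

lemma mu_U: "mu_U_is (RO P) (\<subseteq>) U M"
  unfolding mu_U_is_def mu_is_def
proof (intro conjI allI impI)
  obtain i \<alpha> where i: "i \<in> M" "\<alpha> \<in> L" using M_inf L_inf by fastforce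
  \<comment> \<open>The whole order serves as an initial segment of least size:
    \<open>card_upw\<close> bounds it from above, \<open>card_init_seg\<close> from below.\<close>
  have *: "init_seg (upw P U) (upl P U) (upw P U)" unfolding init_seg_def by blast
  have **: "upow_omega (RO P) (\<subseteq>) U \<subset> upw P U" using num_cls[OF i] omega_sub by blast
  have "|upw P U| =o |M|" using card_init_seg[OF * **] card_upw by (simp add: ordIso_iff_ordLeq)
  then show "\<exists>I. init_seg (upw P U) (upl P U) I \<and> upow_omega (RO P) (\<subseteq>) U \<subset> I \<and> |I| =o |M|"
    using * ** by blast
next
  fix I assume "init_seg (upw P U) (upl P U) I \<and> upow_omega (RO P) (\<subseteq>) U \<subset> I"
  then show "|M| \<le>o |I|" using card_init_seg by blast
qed

text \<open>In a fixed column, numbers of later levels are smaller by \<open>num_less\<close>, and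
  every nonstandard element exceeds one of them. For a shorter sequence the levels bounding its
  terms have a common bound in \<open>L\<close> by regularity, and a generic number on that level is
  nonstandard and below every term.\<close>

lemma lcf_U: "lcf_U_is (RO P) (\<subseteq>) U L"
  unfolding lcf_U_is_def lcf_is_def
proof (intro conjI allI impI)
  obtain i where i: "i \<in> M" using M_inf by fastforce
  let ?a = "\<lambda>\<alpha>. cls P U (num i \<alpha>)"
  have "coinitial_dec_seq (upw P U) (upl P U) (upow_omega (RO P) (\<subseteq>) U) |L| ?a"
    unfolding coinitial_dec_seq_def Field_card_of
  proof (intro conjI ballI allI impI)
    fix \<alpha> assume "\<alpha> \<in> L"
    then show "?a \<alpha> \<in> upw P U - upow_omega (RO P) (\<subseteq>) U" using num_cls[OF i] by blast
  next
    fix \<alpha> \<beta> assume "(\<alpha>, \<beta>) \<in> |L| \<and> \<alpha> \<noteq> \<beta>"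
    then have \<alpha>: "\<alpha> \<in> below \<beta>" unfolding underS_def by simp
    then have L: "\<alpha> \<in> L" "\<beta> \<in> L" using below_L by blast+
    have "tv P (<) (num i \<beta>) (num i \<alpha>) \<in> U"
      using num_less[OF i L(2) num_parts[OF i L(1)] num_nonstd[OF i L(1)] num_level_alg[OF i L(1) \<alpha>]] .
    then show "upl P U (?a \<beta>) (?a \<alpha>)" using upl_cls[OF ultraU num_parts[OF i L(2)] num_parts[OF i L(1)]] by blast
  next
    fix b assume b: "b \<in> upw P U" "\<forall>\<alpha>\<in>L. upl P U b (?a \<alpha>)"
    show "b \<in> upow_omega (RO P) (\<subseteq>) U"
    proof (rule ccontr)
      assume "b \<notin> upow_omega (RO P) (\<subseteq>) U"
      then obtain \<alpha> where \<alpha>: "\<alpha> \<in> L" "upl P U (?a \<alpha>) b" using nonstd_cls[of b] b(1) i by blast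
      then show False using upl_asym[OF ultraU b(1), of "?a \<alpha>"] b(2) num_cls[OF i \<alpha>(1)] by blast
    qed
  qed
  then show "\<exists>(r :: 'l rel) a. Card_order r \<and> r =o |L| \<and>
      coinitial_dec_seq (upw P U) (upl P U) (upow_omega (RO P) (\<subseteq>) U) r a"
    using card_of_Card_order[of L] ordIso_refl[OF card_of_Card_order[of L]] by blast
next
  fix r :: "'l rel" and a
  assume r: "Card_order r \<and> r <o |L|"
  obtain i where i: "i \<in> M" using M_inf by fastforce
  show "\<not> coinitial_dec_seq (upw P U) (upl P U) (upow_omega (RO P) (\<subseteq>) U) r a"
  proof
    assume a: "coinitial_dec_seq (upw P U) (upl P U) (upow_omega (RO P) (\<subseteq>) U) r a"
    have "\<forall>\<gamma>\<in>Field r. \<exists>\<alpha>\<in>L. \<forall>\<beta>. \<alpha> = \<beta> \<or> \<alpha> \<in> below \<beta> \<longrightarrow> \<beta> \<in> L \<longrightarrow>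
        (\<forall>i\<in>M. upl P U (cls P U (num i \<beta>)) (a \<gamma>))"
      using a nonstd_cls unfolding coinitial_dec_seq_def by blast
    then obtain f where f: "\<And>\<gamma>. \<gamma> \<in> Field r \<Longrightarrow> f \<gamma> \<in> L"
      "\<And>\<gamma> \<beta>. \<gamma> \<in> Field r \<Longrightarrow> f \<gamma> \<in> below \<beta> \<Longrightarrow> upl P U (cls P U (num i \<beta>)) (a \<gamma>)"
      using i below_L by metis
    have "|Field r| <o |L|" using r card_of_Field_ordIso ordIso_ordLess_trans by blast
    then have "|f ` Field r| <o |L|" using card_of_image ordLeq_ordLess_trans by blast
    moreover have "f ` Field r \<subseteq> L" using f(1) by blast
    ultimately obtain \<beta> where \<beta>: "\<beta> \<in> L" "f ` Field r \<subseteq> below \<beta>" using regular_bound[OF regL L_inf] by blast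
    then have "\<forall>\<gamma>\<in>Field r. upl P U (cls P U (num i \<beta>)) (a \<gamma>)" using f(2) by blast
    then show False using a num_cls[OF i \<beta>(1)] unfolding coinitial_dec_seq_def by blast
  qed
qed

end

section \<open>Coding of the points by elements of \<open>M\<close>, and the conclusion\<close>

theorem mainTheorem14:
  fixes K :: "'k set" and L :: "'l set" and M :: "'m set"
  assumes "|UNIV :: nat set| \<le>o |K|"
    and "|K| <o |L|"
    and "|L| \<le>o |M|"
    and "|M| ^c |K| =o |M|"
    and "regularCard |L|"
  shows "\<exists>(C :: 'm set set set) le U.
           complete_BA C le \<and> chain_condition C le (cardSuc (card_of K)) \<and>
           BA_ultrafilter C le U \<and> aleph1_incomplete C le U \<and> good C le U K \<and>
           mu_U_is C le U M \<and> lcf_U_is C le U L"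
proof -
  have K_inf: "infinite K" using assms(1) infinite_iff_card_of_nat by blast
  then have L_inf: "infinite L" using card_of_ordLeq_infinite[OF ordLess_imp_ordLeq[OF assms(2)]] by blast
  then have M_inf: "infinite M" using card_of_ordLeq_infinite[OF assms(3)] by blast
  have K_M: "|K| \<le>o |M|" using ordLeq_transitive[OF ordLess_imp_ordLeq[OF assms(2)] assms(3)] .
  have "|Fpow K| \<le>o |M|" using ordLeq_transitive[OF card_of_Fpow_le[OF K_inf] K_M] .
  then have "|M \<times> L \<times> Fpow K \<times> (UNIV :: nat set)| \<le>o |M|"
    using assms(3) nat_le_infinite[OF M_inf] ordLeq_refl[OF card_of_Card_order, of M]
    by (intro card_of_Times_le M_inf) simp_all
  \<comment> \<open>The carrier must consist of sets of sets of elements of type \<open>'m\<close>,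
    so the quadruples of column, level, set value and number are coded by elements of
    \<open>M\<close>; the inverse of \<open>h\<close> decodes them.\<close>
  then obtain h where h: "inj_on h (M \<times> L \<times> Fpow K \<times> (UNIV :: nat set))"
    "h ` (M \<times> L \<times> Fpow K \<times> (UNIV :: nat set)) \<subseteq> M"
    using card_of_ordLeq[of "M \<times> L \<times> Fpow K \<times> (UNIV :: nat set)" M] by blast
  define T where "T = M \<times> L \<times> Fpow K \<times> (UNIV :: nat set)"
  define g where "g = inv_into T h"
  have hT: "inj_on h T" using h(1) unfolding T_def .
  have gh: "g (h t) = t" if "t \<in> T" for t unfolding g_def using inv_into_f_f[OF hT that] .
  interpret conditions "h ` T" "\<lambda>x. fst (g x)" "\<lambda>x. fst (snd (g x))" "\<lambda>x. fst (snd (snd (g x)))"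
    "\<lambda>x. snd (snd (snd (g x)))" M L K
  proof
    fix i \<alpha> s k assume "i \<in> M" "\<alpha> \<in> L" "s \<in> Fpow K"
    then have "(i, \<alpha>, s, k) \<in> T" unfolding T_def by simp
    then show "\<exists>x\<in>h ` T. fst (g x) = i \<and> fst (snd (g x)) = \<alpha> \<and> fst (snd (snd (g x))) = s \<and> snd (snd (snd (g x))) = k"
      using gh by (intro bexI[of _ "h (i, \<alpha>, s, k)"]) auto
  next
    fix x assume "x \<in> h ` T"
    then have "g x \<in> T" using gh by auto
    then show "fst (g x) \<in> M" "fst (snd (g x)) \<in> L" "fst (snd (snd (g x))) \<in> Fpow K" unfolding T_def by auto
  next
    fix x y assume "x \<in> h ` T" "y \<in> h ` T" "fst (g x) = fst (g y)" "fst (snd (g x)) = fst (snd (g y))"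
      "fst (snd (snd (g x))) = fst (snd (snd (g y)))" "snd (snd (snd (g x))) = snd (snd (snd (g y)))"
    then have "g x = g y" "x \<in> h ` T" "y \<in> h ` T" by (simp_all add: prod_eq_iff)
    then show "x = y" using gh by auto
  qed (fact K_inf)
  obtain U where U: "ultra P U" "\<forall>\<alpha>\<in>L. step_filter (U \<inter> level_alg (below \<alpha>)) \<alpha> \<inter> level_alg (upto_lev \<alpha>) \<subseteq> U"
    using generic_ultra_exists by blast
  interpret generic_ultra "h ` T" "\<lambda>x. fst (g x)" "\<lambda>x. fst (snd (g x))" "\<lambda>x. fst (snd (snd (g x)))"
    "\<lambda>x. snd (snd (snd (g x)))" M L K U
    by unfold_locales (use U assms in auto)
  have "complete_BA (RO P) (\<subseteq>) \<and> chain_condition (RO P) (\<subseteq>) (cardSuc (card_of K)) \<and>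
      BA_ultrafilter (RO P) (\<subseteq>) U \<and> aleph1_incomplete (RO P) (\<subseteq>) U \<and> good (RO P) (\<subseteq>) U K \<and>
      mu_U_is (RO P) (\<subseteq>) U M \<and> lcf_U_is (RO P) (\<subseteq>) U L"
    using complete_BA_RO RO_chain_condition BA_ultrafilter_RO[OF ultraU] incomplete_U good_U mu_U lcf_U by blast
  then show ?thesis by blast
qed

end
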